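(* Consider the Lévy model with $1<\alpha<2$ and the continuous perturbation. For any $0\le\beta<\infty$ and $0<\varepsilon<2/\alpha-1$, there exist two constants $c=c(\beta)>0$ and $K=K(\beta,\varepsilon)>0$ such that for any $t\ge0$ and any $N\ge1$, $$\mathbb E\langle R(\sigma,\tau)^2\rangle_t\le\frac{K}{N^{(\frac2\alpha-1-\varepsilon)\min(1,ct)}}.$$
   Context: Lévy model: let $1<\alpha<2$ and let $X$ be a symmetric random variable with $\mathbb P(|X|>x)=L(x)/x^\alpha$ for all $x>0$, where $L:(0,\infty)\to(0,\infty)$ is slowly varying at $\infty$. Let $\rho:\mathbb R\to\mathbb R$ be a non-decreasing function such that $\rho(J)$ has the law of $X$ when $J\sim N(0,1)$. Let $(J_{ij})_{1\le i,j\le N}$ be i.i.d. standard Gaussians, and $a_N=\inf\{x>0:\mathbb P(|X|>x)\le1/N\}$ ($N$ is understood to be such that $a_N>0$, so that the Hamiltonian is well defined). The Hamiltonian is $$H_N(\sigma)=\frac1{a_N}\sum_{i,j=1}^N\rho(J_{ij})\sigma_i\sigma_j,\qquad\sigma\in\{\pm1\}^N,$$ and the Gibbs measure is $G_{J,\beta}(\sigma)\propto e^{\beta H_N(\sigma)}$. Continuous perturbation: $J_{ij}(t)=e^{-t}J_{ij}+\sqrt{1-e^{-2t}}\,J'_{ij}$ with $J'=(J'_{ij})$ an independent copy of $J$; the perturbed Hamiltonian uses $J(t)$ in place of $J$. $R(\sigma,\tau)=\frac1N\sum_{i=1}^N\sigma_i\tau_i$; $\langle\cdot\rangle_t$ is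 the expectation over $(\sigma,\tau)\sim G_{J,\beta}\otimes G_{J(t),\beta}$, and $\mathbb E$ is the expectation over $J,J'$. The constants $c,K$ do not depend on $N$ and $t$ (they may depend on the law of $X$, in particular on $\alpha$). *)

theory Defs
  imports "HOL-Probability.Probability"
begin

definition slowly_varying :: "(real \<Rightarrow> real) \<Rightarrow> bool" where
  "slowly_varying L \<longleftrightarrow> (\<forall>s>0. ((\<lambda>x. L (s * x) / L x) \<longlongrightarrow> 1) at_top)"

text \<open>Functions on \<open>(0,\<infinity>)\<close>, such as \<open>L\<close> below, are total functions on the reals whose values
  outside \<open>(0,\<infinity>)\<close> are never constrained.\<close>

definition levy_variable :: "real \<Rightarrow> (real \<Rightarrow> real) \<Rightarrow> 'a measure \<Rightarrow> ('a \<Rightarrow> real) \<Rightarrow> bool" where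
  "levy_variable \<alpha> L P X \<longleftrightarrow>
     prob_space P \<and> X \<in> borel_measurable P \<and>
     distr P borel (\<lambda>\<omega>. - X \<omega>) = distr P borel X \<and>
     (\<forall>x>0. L x > 0) \<and> slowly_varying L \<and>
     (\<forall>x>0. measure P {\<omega> \<in> space P. \<bar>X \<omega>\<bar> > x} = L x / x powr \<alpha>)"

definition gaussian_representation :: "(real \<Rightarrow> real) \<Rightarrow> 'a measure \<Rightarrow> ('a \<Rightarrow> real) \<Rightarrow> bool" where
  "gaussian_representation \<rho> P X \<longleftrightarrow>
     mono \<rho> \<and> distr (density lborel (\<lambda>x. ennreal (std_normal_density x))) borel \<rho> = distr P borel X"

definition levy_scale :: "'a measure \<Rightarrow> ('a \<Rightarrow> real) \<Rightarrow> nat \<Rightarrow> real" where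
  "levy_scale P X N =
     Inf {x. 0 < x \<and> measure P {\<omega> \<in> space P. \<bar>X \<omega>\<bar> > x} \<le> 1 / real N}"

definition spins :: "nat \<Rightarrow> (nat \<Rightarrow> real) set" where
  "spins N = {1..N} \<rightarrow>\<^sub>E {-1, 1}"

text \<open>In the next three definitions \<open>g\<close> is a realisation of the Gaussian array and \<open>a\<close> the
  normalisation \<open>a\<^sub>N\<close>.\<close>

definition hamiltonian ::
    "(real \<Rightarrow> real) \<Rightarrow> real \<Rightarrow> nat \<Rightarrow> (nat \<times> nat \<Rightarrow> real) \<Rightarrow> (nat \<Rightarrow> real) \<Rightarrow> real" where
  "hamiltonian \<rho> a N g \<sigma> = 1 / a * (\<Sum>i=1..N. \<Sum>j=1..N. \<rho> (g (i, j)) * \<sigma> i * \<sigma> j)"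

definition gibbs ::
    "(real \<Rightarrow> real) \<Rightarrow> real \<Rightarrow> nat \<Rightarrow> real \<Rightarrow> (nat \<times> nat \<Rightarrow> real) \<Rightarrow> (nat \<Rightarrow> real) \<Rightarrow> real" where
  "gibbs \<rho> a N \<beta> g \<sigma> =
     exp (\<beta> * hamiltonian \<rho> a N g \<sigma>) / (\<Sum>\<tau>\<in>spins N. exp (\<beta> * hamiltonian \<rho> a N g \<tau>))"

text \<open>Expectation of \<open>f\<close> under the product of the Gibbs measures for the arrays \<open>g\<close> and \<open>g'\<close>.\<close>

definition gibbs_average2 ::
    "(real \<Rightarrow> real) \<Rightarrow> real \<Rightarrow> nat \<Rightarrow> real \<Rightarrow> (nat \<times> nat \<Rightarrow> real) \<Rightarrow> (nat \<times> nat \<Rightarrow> real) \<Rightarrow>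
     ((nat \<Rightarrow> real) \<Rightarrow> (nat \<Rightarrow> real) \<Rightarrow> real) \<Rightarrow> real" where
  "gibbs_average2 \<rho> a N \<beta> g g' f =
     (\<Sum>\<sigma>\<in>spins N. \<Sum>\<tau>\<in>spins N. f \<sigma> \<tau> * gibbs \<rho> a N \<beta> g \<sigma> * gibbs \<rho> a N \<beta> g' \<tau>)"

definition overlap :: "nat \<Rightarrow> (nat \<Rightarrow> real) \<Rightarrow> (nat \<Rightarrow> real) \<Rightarrow> real" where
  "overlap N \<sigma> \<tau> = 1 / real N * (\<Sum>i=1..N. \<sigma> i * \<tau> i)"

text \<open>Joint independence of all \<open>2N\<^sup>2\<close> entries says both that each array has independent entries
  and that the arrays \<open>J\<close> and \<open>J'\<close> are independent of each other.\<close>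

definition gaussian_disorder ::
    "'a measure \<Rightarrow> nat \<Rightarrow> (nat \<times> nat \<Rightarrow> 'a \<Rightarrow> real) \<Rightarrow> (nat \<times> nat \<Rightarrow> 'a \<Rightarrow> real) \<Rightarrow> bool" where
  "gaussian_disorder M N J J' \<longleftrightarrow>
     prob_space M \<and>
     (\<forall>e\<in>{1..N} \<times> {1..N}. distributed M lborel (J e) std_normal_density \<and>
                           distributed M lborel (J' e) std_normal_density) \<and>
     prob_space.indep_vars M (\<lambda>_. borel) (case_sum J J')
       (({1..N} \<times> {1..N}) <+> ({1..N} \<times> {1..N}))"

definition perturbed :: "real \<Rightarrow> real \<Rightarrow> real \<Rightarrow> real" where
  "perturbed t x y = exp (- t) * x + sqrt (1 - exp (- 2 * t)) * y"

definition expected_overlap_sq ::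
    "(real \<Rightarrow> real) \<Rightarrow> real \<Rightarrow> nat \<Rightarrow> real \<Rightarrow> real \<Rightarrow>
     'a measure \<Rightarrow> (nat \<times> nat \<Rightarrow> 'a \<Rightarrow> real) \<Rightarrow> (nat \<times> nat \<Rightarrow> 'a \<Rightarrow> real) \<Rightarrow> real" where
  "expected_overlap_sq \<rho> a N \<beta> t M J J' =
     (\<integral>\<omega>. gibbs_average2 \<rho> a N \<beta> (\<lambda>e. J e \<omega>) (\<lambda>e. perturbed t (J e \<omega>) (J' e \<omega>))
            (\<lambda>\<sigma> \<tau>. (overlap N \<sigma> \<tau>)\<^sup>2) \<partial>M)"

end

theory Submission
  imports Defs
begin

text \<open>Expand \<open>E\<langle>R\<^sup>2\<rangle>\<^sub>t\<close> as the average over \<open>i, j\<close> of \<open>\<phi>(t) = E f(J) f(J(t))\<close> with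
  \<open>f = \<langle>\<sigma>\<^sub>i\<sigma>\<^sub>j\<rangle>\<close>. By reversibility \<open>\<phi>(2t) = E (P\<^sub>t f)\<^sup>2\<close> for the Ornstein-Uhlenbeck semigroup
  \<open>P\<close>, so \<open>\<phi>(t)\<^sup>2 \<le> \<phi>(2t)\<close>, and it suffices to bound \<open>\<phi>(t)\<close> for \<open>i \<noteq> j\<close> and \<open>t\<close> beyond a constant \<open>T\<close>.

  Negating all couplings at site \<open>i\<close> in \<open>J(t)\<close> changes the sign of \<open>f(J(t))\<close>, and can be done one
  coupling \<open>e\<close> at a time. The law of the pair of couplings at \<open>e\<close> is invariant under simultaneous
  negation, so each step costs at most the product of the two discrete derivatives of \<open>f\<close>, i.e.
  \<open>O(a\<^sub>N\<^sup>-\<^sup>2 E|\<rho>(J\<^sub>e) \<rho>(J\<^sub>e(t))|)\<close>. As \<open>X\<close> has a moment of order \<open>q > 1\<close>, the last expectation is bounded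
  uniformly in \<open>t \<ge> T\<close> by a crude form of hypercontractivity. Summing over the fewer than \<open>2N\<close>
  couplings at \<open>i\<close> gives \<open>\<phi>(t) = O(N a\<^sub>N\<^sup>-\<^sup>2)\<close>, where \<open>a\<^sub>N\<close> is of order \<open>N\<^sup>1\<^sup>/\<^sup>\<alpha>\<close> up to a slowly varying
  factor.\<close>

text \<open>The obstacle is that \<open>X\<close> has infinite variance: at time 0 the product of
  the two couplings has infinite mean, so no second-moment estimate for a flip is available. Noise
  cures this. If \<open>exp (- t) \<le> (q - 1) / 2\<close>, the density of a pair of Gaussians is
  dominated by a constant times a product of weights \<open>exp (- x^2 / (q + 1))\<close>, against
  which \<open>\<bar>\<rho>\<bar>\<close> is integrable as soon as \<open>\<bar>X\<bar>\<close> has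
  a moment of order q > 1. The choice q = (1 + \<alpha>) / 2 gives T = ln (4 / (\<alpha> - 1)), and
  c = 1 / (2 T) depends on \<alpha> alone. Times below T are reached by iterating the squaring
  inequality: k doublings cost the exponent 1 / 2^k, which for the least sufficient k is at least
  min(1, t / (2 T)). Discrete derivatives are used because \<rho> has no regularity beyond
  monotonicity. Nor is \<rho> assumed odd: the symmetry of \<open>X\<close> makes it odd off a
  countable set, which the pair law does not charge for t > 0. The terms with i = j contribute 1/N,
  which is harmless because \<alpha> > 1 keeps the exponent of N below 1.\<close>

section \<open>Product measures of pairs and the law of the disorder\<close>

text \<open>Allows one array to be frozen while the other is averaged. The induction splits off one
  coordinate; with nonnegative integrals Fubini asks for no integrability.\<close>

lemma nn_integral_PiM_pair:
  fixes A :: "'b measure" and B :: "'c measure"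
  assumes "prob_space A" and "prob_space B" and "finite I"
    and "G \<in> borel_measurable (PiM I (\<lambda>_. A \<Otimes>\<^sub>M B))"
  shows "(\<integral>\<^sup>+w. G w \<partial>PiM I (\<lambda>_. A \<Otimes>\<^sub>M B)) =
    (\<integral>\<^sup>+u. \<integral>\<^sup>+v. G (\<lambda>e\<in>I. (u e, v e)) \<partial>PiM I (\<lambda>_. B) \<partial>PiM I (\<lambda>_. A))"
  using assms(3,4)
proof (induction I arbitrary: G)
  case empty
  interpret AB: product_sigma_finite "\<lambda>_::'a. A \<Otimes>\<^sub>M B"
    by (intro product_sigma_finite.intro prob_space_imp_sigma_finite prob_space_pair assms)
  show ?case
    by (simp add: PiM_empty nn_integral_count_space_finite)
next
  case (insert i I)
  interpret A: prob_space A by fact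
  interpret B: prob_space B by fact
  interpret AB: pair_prob_space A B ..
  interpret pAB: product_sigma_finite "\<lambda>_::'a. A \<Otimes>\<^sub>M B"
    by (intro product_sigma_finite.intro prob_space_imp_sigma_finite prob_space_pair assms)
  interpret pA: product_prob_space "\<lambda>_::'a. A" by standard
  interpret pB: product_prob_space "\<lambda>_::'a. B" by standard
  interpret PA: prob_space "PiM I (\<lambda>_. A)" by (intro prob_space_PiM assms)
  interpret PB: prob_space "PiM I (\<lambda>_. B)" by (intro prob_space_PiM assms)
  interpret PB': prob_space "PiM (insert i I) (\<lambda>_. B)" by (intro prob_space_PiM assms)
  interpret AP: pair_sigma_finite A "PiM I (\<lambda>_. B)" ..
  note [measurable] = insert.prems
  have H: "(\<lambda>x. G ((\<lambda>e\<in>I. (fst x e, fst (snd x) e))(i := snd (snd x))))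
      \<in> borel_measurable (PiM I (\<lambda>_. A) \<Otimes>\<^sub>M (PiM I (\<lambda>_. B) \<Otimes>\<^sub>M (A \<Otimes>\<^sub>M B)))"
  proof (rule measurable_compose[OF _ insert.prems], rule measurable_fun_upd[where J=I])
    show "(\<lambda>x. \<lambda>e\<in>I. (fst x e, fst (snd x) e)) \<in> PiM I (\<lambda>_. A) \<Otimes>\<^sub>M (PiM I (\<lambda>_. B) \<Otimes>\<^sub>M (A \<Otimes>\<^sub>M B))
        \<rightarrow>\<^sub>M PiM I (\<lambda>_. A \<Otimes>\<^sub>M B)"
      by (intro measurable_restrict measurable_Pair)
        (auto intro: measurable_compose[OF measurable_fst measurable_component_singleton]
           measurable_compose[OF measurable_compose[OF measurable_snd measurable_fst] measurable_component_singleton])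
  qed auto
  have e: "(\<lambda>e\<in>insert i I. ((u(i:=p)) e, (v(i:=q)) e)) = (\<lambda>e\<in>I. (u e, v e))(i := (p,q))"
    for u v p q using insert.hyps by (auto simp: fun_eq_iff)
  have "(\<integral>\<^sup>+w. G w \<partial>PiM (insert i I) (\<lambda>_. A \<Otimes>\<^sub>M B)) =
     (\<integral>\<^sup>+w. \<integral>\<^sup>+z. G (w(i := z)) \<partial>(A \<Otimes>\<^sub>M B) \<partial>PiM I (\<lambda>_. A \<Otimes>\<^sub>M B))"
    by (rule pAB.product_nn_integral_insert) (use insert in auto)
  also have "\<dots> = (\<integral>\<^sup>+u. \<integral>\<^sup>+v. \<integral>\<^sup>+z. G ((\<lambda>e\<in>I. (u e, v e))(i := z)) \<partial>(A \<Otimes>\<^sub>M B) \<partial>PiM I (\<lambda>_. B) \<partial>PiM I (\<lambda>_. A))"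
    by (rule insert.IH) measurable
  also have "\<dots> = (\<integral>\<^sup>+u. \<integral>\<^sup>+v. \<integral>\<^sup>+p. \<integral>\<^sup>+q. G ((\<lambda>e\<in>I. (u e, v e))(i := (p,q))) \<partial>B \<partial>A \<partial>PiM I (\<lambda>_. B) \<partial>PiM I (\<lambda>_. A))"
  proof (intro nn_integral_cong)
    fix u v assume [measurable]: "u \<in> space (PiM I (\<lambda>_. A))" "v \<in> space (PiM I (\<lambda>_. B))"
    then have [measurable]: "(\<lambda>e\<in>I. (u e, v e)) \<in> space (PiM I (\<lambda>_. A \<Otimes>\<^sub>M B))"
      by (auto simp: space_PiM space_pair_measure PiE_iff)
    have [measurable]: "(\<lambda>z. G ((\<lambda>e\<in>I. (u e, v e))(i := z))) \<in> borel_measurable (A \<Otimes>\<^sub>M B)"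
      by (rule measurable_compose[OF _ insert.prems]) (rule measurable_fun_upd[where J=I], auto)
    show "(\<integral>\<^sup>+z. G ((\<lambda>e\<in>I. (u e, v e))(i := z)) \<partial>(A \<Otimes>\<^sub>M B)) =
      (\<integral>\<^sup>+p. \<integral>\<^sup>+q. G ((\<lambda>e\<in>I. (u e, v e))(i := (p,q))) \<partial>B \<partial>A)"
      by (subst B.nn_integral_fst[symmetric]) auto
  qed
  \<comment> \<open>The new coordinate \<open>p\<close> of the first array has to move outside the
    old coordinates \<open>v\<close> of the second.\<close>
  also have "\<dots> = (\<integral>\<^sup>+u. \<integral>\<^sup>+p. \<integral>\<^sup>+v. \<integral>\<^sup>+q. G ((\<lambda>e\<in>I. (u e, v e))(i := (p,q))) \<partial>B \<partial>PiM I (\<lambda>_. B) \<partial>A \<partial>PiM I (\<lambda>_. A))"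
  proof (intro nn_integral_cong)
    fix u assume [measurable]: "u \<in> space (PiM I (\<lambda>_. A))"
    show "(\<integral>\<^sup>+v. \<integral>\<^sup>+p. \<integral>\<^sup>+q. G ((\<lambda>e\<in>I. (u e, v e))(i := (p,q))) \<partial>B \<partial>A \<partial>PiM I (\<lambda>_. B)) =
      (\<integral>\<^sup>+p. \<integral>\<^sup>+v. \<integral>\<^sup>+q. G ((\<lambda>e\<in>I. (u e, v e))(i := (p,q))) \<partial>B \<partial>PiM I (\<lambda>_. B) \<partial>A)"
    proof (rule AP.Fubini', goal_cases)
      case 1
      have "(\<lambda>x. \<integral>\<^sup>+q. G ((\<lambda>e\<in>I. (u e, snd x e))(i := (fst x,q))) \<partial>B) \<in> borel_measurable (A \<Otimes>\<^sub>M PiM I (\<lambda>_. B))"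
        using measurable_compose[OF _ H, of "\<lambda>x. (u, snd (fst x), fst (fst x), snd x)" "(A \<Otimes>\<^sub>M PiM I (\<lambda>_. B)) \<Otimes>\<^sub>M B"]
        by (intro B.borel_measurable_nn_integral) (simp add: split_beta')
      then show ?case by (simp add: split_beta')
    qed
  qed
  also have "\<dots> = (\<integral>\<^sup>+u. \<integral>\<^sup>+p. \<integral>\<^sup>+v. G (\<lambda>e\<in>insert i I. ((u(i:=p)) e, v e)) \<partial>PiM (insert i I) (\<lambda>_. B) \<partial>A \<partial>PiM I (\<lambda>_. A))"
  proof (intro nn_integral_cong)
    fix u p assume [measurable]: "u \<in> space (PiM I (\<lambda>_. A))" "p \<in> space A"
    show "(\<integral>\<^sup>+v. \<integral>\<^sup>+q. G ((\<lambda>e\<in>I. (u e, v e))(i := (p,q))) \<partial>B \<partial>PiM I (\<lambda>_. B)) =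
      (\<integral>\<^sup>+v. G (\<lambda>e\<in>insert i I. ((u(i:=p)) e, v e)) \<partial>PiM (insert i I) (\<lambda>_. B))"
      by (subst pB.product_nn_integral_insert) (use insert.hyps in \<open>auto simp: e[symmetric] simp del: fun_upd_apply intro!: measurable_compose[OF _ insert.prems]\<close>)
  qed
  also have "\<dots> = (\<integral>\<^sup>+u. \<integral>\<^sup>+v. G (\<lambda>e\<in>insert i I. (u e, v e)) \<partial>PiM (insert i I) (\<lambda>_. B) \<partial>PiM (insert i I) (\<lambda>_. A))"
    by (rule pA.product_nn_integral_insert[symmetric]) (use insert.hyps in measurable)
  finally show ?case .
qed

lemma measurable_zip_PiM:
  "(\<lambda>p. \<lambda>e\<in>I. (fst p e, snd p e)) \<in> PiM I (\<lambda>_. A) \<Otimes>\<^sub>M PiM I (\<lambda>_. B) \<rightarrow>\<^sub>M PiM I (\<lambda>_. A \<Otimes>\<^sub>M B)"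
  by (intro measurable_restrict measurable_Pair)
    (auto intro: measurable_compose[OF measurable_fst measurable_component_singleton]
       measurable_compose[OF measurable_snd measurable_component_singleton])

text \<open>The preceding identity on indicators; as an image measure it also serves Bochner
  integrals.\<close>

lemma PiM_pair_eq_distr:
  assumes "prob_space A" and "prob_space B" and "finite I"
  shows "PiM I (\<lambda>_. A \<Otimes>\<^sub>M B) =
    distr (PiM I (\<lambda>_. A) \<Otimes>\<^sub>M PiM I (\<lambda>_. B)) (PiM I (\<lambda>_. A \<Otimes>\<^sub>M B)) (\<lambda>p. \<lambda>e\<in>I. (fst p e, snd p e))"
proof (rule measure_eqI)
  fix X assume "X \<in> sets (PiM I (\<lambda>_. A \<Otimes>\<^sub>M B))"
  then have X: "(indicator X :: _ \<Rightarrow> ennreal) \<in> borel_measurable (PiM I (\<lambda>_. A \<Otimes>\<^sub>M B))" and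
    [simp]: "X \<in> sets (PiM I (\<lambda>_. A \<Otimes>\<^sub>M B))" by auto
  interpret PB: prob_space "PiM I (\<lambda>_. B)" by (intro prob_space_PiM assms)
  show "emeasure (PiM I (\<lambda>_. A \<Otimes>\<^sub>M B)) X = emeasure (distr (PiM I (\<lambda>_. A) \<Otimes>\<^sub>M PiM I (\<lambda>_. B))
      (PiM I (\<lambda>_. A \<Otimes>\<^sub>M B)) (\<lambda>p. \<lambda>e\<in>I. (fst p e, snd p e))) X"
    using PB.nn_integral_fst[OF measurable_compose[OF measurable_zip_PiM X]]
    by (simp add: nn_integral_indicator[symmetric] nn_integral_PiM_pair[OF assms X]
        nn_integral_distr[OF measurable_zip_PiM, of "indicator X"] X del: nn_integral_indicator)
qed simp

text \<open>Literally the measure in \<open>gaussian_representation\<close>, so that unfolding turns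
  that assumption into one on \<open>distr gauss borel \<rho>\<close>.\<close>

definition gauss :: "real measure" where
  "gauss = density lborel (\<lambda>x. ennreal (std_normal_density x))"

lemma sets_gauss [measurable_cong, simp]: "sets gauss = sets borel"
  and space_gauss [simp]: "space gauss = UNIV"
  by (simp_all add: gauss_def)

lemma prob_space_gauss: "prob_space gauss"
  unfolding gauss_def by (rule prob_space_normal_density) simp

lemma distr_gaussian_disorder:
  assumes "gaussian_disorder M N J J'" and "1 \<le> N" and I: "I = {1..N} \<times> {1..N}"
  shows "distr M (PiM I (\<lambda>_. borel \<Otimes>\<^sub>M borel)) (\<lambda>\<omega>. \<lambda>e\<in>I. (J e \<omega>, J' e \<omega>)) = PiM I (\<lambda>_. gauss \<Otimes>\<^sub>M gauss)"
proof -
  interpret prob_space M using assms by (simp add: gaussian_disorder_def)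
  have dist: "distr M borel (J e) = gauss" "distr M borel (J' e) = gauss"
    and [measurable]: "J e \<in> borel_measurable M" "J' e \<in> borel_measurable M" if "e \<in> I" for e
  proof -
    have "distributed M lborel (J e) std_normal_density" "distributed M lborel (J' e) std_normal_density"
      using assms that by (auto simp: gaussian_disorder_def)
    then show "distr M borel (J e) = gauss" "distr M borel (J' e) = gauss"
      "J e \<in> borel_measurable M" "J' e \<in> borel_measurable M"
      by (auto simp: distributed_def gauss_def cong: distr_cong)
  qed
  have ind: "indep_vars (\<lambda>_. borel) (case_sum J J') (I <+> I)"
    using assms by (simp add: gaussian_disorder_def)
  \<comment> \<open>The blocks \<open>{Inl e, Inr e}\<close> are disjoint, so the restrictions of
    the family to them are independent; each is then read as a pair.\<close>
  have "indep_vars (\<lambda>_. borel \<Otimes>\<^sub>M borel)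
     (\<lambda>e \<omega>. (\<lambda>r. (r (Inl e), r (Inr e))) (restrict (\<lambda>i. case_sum J J' i \<omega>) {Inl e, Inr e})) I"
    by (rule indep_vars_compose2[OF indep_vars_restrict[OF ind, of I "\<lambda>e. {Inl e, Inr e}"]])
      (auto simp: disjoint_family_on_def)
  then have "indep_vars (\<lambda>_. borel \<Otimes>\<^sub>M borel) (\<lambda>e \<omega>. (J e \<omega>, J' e \<omega>)) I"
    by simp
  moreover have "distr M (borel \<Otimes>\<^sub>M borel) (\<lambda>\<omega>. (J e \<omega>, J' e \<omega>)) = gauss \<Otimes>\<^sub>M gauss" if "e \<in> I" for e
  proof -
    have "indep_var borel ((\<lambda>r. r (Inl e)) \<circ> (\<lambda>\<omega>. restrict (\<lambda>i. case_sum J J' i \<omega>) {Inl e}))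
       borel ((\<lambda>r. r (Inr e)) \<circ> (\<lambda>\<omega>. restrict (\<lambda>i. case_sum J J' i \<omega>) {Inr e}))"
      by (rule indep_var_compose[OF indep_var_restrict[OF ind]]) (use that in auto)
    then have "indep_var borel (J e) borel (J' e)"
      by (simp add: comp_def)
    then show ?thesis
      using dist[OF that] by (simp add: indep_var_distribution_eq)
  qed
  \<comment> \<open>The criterion by product laws applied next is for nonempty index sets;
    \<open>1 \<le> N\<close> enters here.\<close>
  moreover have "I \<noteq> {}" using assms by auto
  ultimately show ?thesis
    by (subst (asm) indep_vars_iff_distr_eq_PiM') (auto cong: PiM_cong)
qed

section \<open>Pairs of Ornstein-Uhlenbeck variables\<close>

text \<open>The stationary Ornstein-Uhlenbeck process observed at the times 0 and t.\<close>

definition ou_pair :: "real \<Rightarrow> (real \<times> real) measure" where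
  "ou_pair t = distr (gauss \<Otimes>\<^sub>M gauss) (borel \<Otimes>\<^sub>M borel) (\<lambda>p. (fst p, perturbed t (fst p) (snd p)))"

lemma measurable_perturbed [measurable]:
  assumes [measurable]: "f \<in> borel_measurable M" "g \<in> borel_measurable M"
  shows "(\<lambda>x. perturbed t (f x) (g x)) \<in> borel_measurable M"
  unfolding perturbed_def by measurable

lemma measurable_normal_density [measurable]:
  assumes [measurable]: "f \<in> borel_measurable M" "g \<in> borel_measurable M"
  shows "(\<lambda>x. normal_density (f x) s (g x)) \<in> borel_measurable M"
  unfolding normal_density_def by measurable

lemma nn_integral_gauss_affine:
  assumes [measurable]: "f \<in> borel_measurable borel" and s: "0 < s"
  shows "(\<integral>\<^sup>+y. f (m + s * y) \<partial>gauss) = (\<integral>\<^sup>+y. ennreal (normal_density m s y) * f y \<partial>lborel)"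
proof -
  have e: "s * normal_density m s (m + s * y) = std_normal_density y" for y
    using s by (simp add: normal_density_def real_sqrt_mult field_simps power_mult_distrib)
  have "(\<integral>\<^sup>+y. ennreal (normal_density m s y) * f y \<partial>lborel) =
    ennreal s * (\<integral>\<^sup>+y. ennreal (normal_density m s (m + s * y)) * f (m + s * y) \<partial>lborel)"
    using s by (subst nn_integral_real_affine[of _ s m]) auto
  also have "\<dots> = (\<integral>\<^sup>+y. ennreal s * (ennreal (normal_density m s (m + s * y)) * f (m + s * y)) \<partial>lborel)"
    by (rule nn_integral_cmult[symmetric]) measurable
  also have "\<dots> = (\<integral>\<^sup>+y. f (m + s * y) \<partial>gauss)"
    unfolding gauss_def using s
    by (subst nn_integral_density) (auto intro!: nn_integral_cong simp: mult.assoc[symmetric] ennreal_mult[symmetric] e)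
  finally show ?thesis by simp
qed

text \<open>The Mehler kernel. At t = 0 the pair sits on the diagonal and has no density, hence the
  condition on t.\<close>

lemma nn_integral_ou_pair:
  assumes G[measurable]: "G \<in> borel_measurable (borel \<Otimes>\<^sub>M borel)" and t: "0 < t"
  shows "(\<integral>\<^sup>+p. G p \<partial>ou_pair t) = (\<integral>\<^sup>+x. \<integral>\<^sup>+y. ennreal (std_normal_density x *
    normal_density (exp (- t) * x) (sqrt (1 - exp (- 2 * t))) y) * G (x, y) \<partial>lborel \<partial>lborel)"
proof -
  interpret g: prob_space gauss by (rule prob_space_gauss)
  have s: "0 < sqrt (1 - exp (- 2 * t))" using t by simp
  have [measurable]: "G \<in> borel_measurable (A \<Otimes>\<^sub>M B)" if "sets A = sets borel" "sets B = sets borel" for A B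
    using G measurable_cong_sets[OF sets_pair_measure_cong[OF that] refl] by blast
  have "(\<integral>\<^sup>+p. G p \<partial>ou_pair t) =
    (\<integral>\<^sup>+p. G (fst p, perturbed t (fst p) (snd p)) \<partial>(gauss \<Otimes>\<^sub>M gauss))"
    unfolding ou_pair_def by (rule nn_integral_distr) measurable
  also have "\<dots> = (\<integral>\<^sup>+x. \<integral>\<^sup>+y. G (x, perturbed t x y) \<partial>gauss \<partial>gauss)"
    by (subst g.nn_integral_fst[symmetric]) simp_all
  also have "\<dots> = (\<integral>\<^sup>+x. \<integral>\<^sup>+y. ennreal (normal_density (exp (- t) * x) (sqrt (1 - exp (- 2 * t))) y) * G (x, y) \<partial>lborel \<partial>gauss)"
    unfolding perturbed_def by (intro nn_integral_cong nn_integral_gauss_affine[OF _ s]) measurable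
  also have "\<dots> = (\<integral>\<^sup>+x. ennreal (std_normal_density x) *
     (\<integral>\<^sup>+y. ennreal (normal_density (exp (- t) * x) (sqrt (1 - exp (- 2 * t))) y) * G (x, y) \<partial>lborel) \<partial>lborel)"
    unfolding gauss_def by (rule nn_integral_density) measurable
  finally show ?thesis
    by (simp add: nn_integral_cmult[symmetric] ennreal_mult mult.assoc)
qed

text \<open>Completing the square in \<open>z\<close>: both sides are the density of \<open>(z, a z + s x', a z + s y')\<close> for
  independent standard Gaussians \<open>z, x', y'\<close> and \<open>s\<^sup>2 = 1 - a\<^sup>2\<close>.\<close>

lemma ou_kernel_compose:
  fixes a x y z :: real
  assumes a: "0 < a" "a < 1"
  shows "std_normal_density z * (normal_density (a * z) (sqrt (1 - a\<^sup>2)) x * normal_density (a * z) (sqrt (1 - a\<^sup>2)) y) =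
    (std_normal_density x * normal_density (a\<^sup>2 * x) (sqrt (1 - a ^ 4)) y) *
      normal_density (a * (x + y) / (1 + a\<^sup>2)) (sqrt ((1 - a\<^sup>2) / (1 + a\<^sup>2))) z"
proof -
  define b where "b = a\<^sup>2"
  have b: "0 < b" "b < 1" using a by (auto simp: b_def power_less_one_iff)
  have a4: "1 - a ^ 4 = (1 - b) * (1 + b)" by (simp add: b_def algebra_simps power4_eq_xxxx power2_eq_square)
  have pos: "1 - b > 0" "1 + b > 0" using b by auto
  have n: "normal_density m (sqrt v) w = 1 / sqrt (2 * pi * v) * exp (- ((w - m)\<^sup>2 / (2 * v)))" if "0 < v" for m v w
    using that by (simp add: normal_density_def)
  have n1: "std_normal_density w = 1 / sqrt (2 * pi) * exp (- (w\<^sup>2 / 2))" for w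
    by (simp add: std_normal_density_def)
  \<comment> \<open>Over the common denominator \<open>2 * ((1 - b) * (1 + b))\<close> the equality
    of the exponents is this polynomial identity, valid because b is the square of a.\<close>
  have alg: "z\<^sup>2 * ((1 - b) * (1 + b)) + (x - a * z)\<^sup>2 * (1 + b) + (y - a * z)\<^sup>2 * (1 + b)
      = x\<^sup>2 * ((1 - b) * (1 + b)) + (y - b * x)\<^sup>2 + (z * (1 + b) - a * (x + y))\<^sup>2"
    using b_def by algebra
  have q: "(z - a * (x + y) / (1 + b))\<^sup>2 / (2 * ((1 - b) / (1 + b))) = (z * (1 + b) - a * (x + y))\<^sup>2 / (2 * ((1 - b) * (1 + b)))"
  proof -
    have "z - a * (x + y) / (1 + b) = (z * (1 + b) - a * (x + y)) / (1 + b)"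
      using pos by (simp add: diff_divide_distrib)
    then show ?thesis using pos by (simp add: power_divide power2_eq_square[of "1 + b"])
  qed
  have cd: "u / 2 = u * ((1 - b) * (1 + b)) / (2 * ((1 - b) * (1 + b)))"
    "u / (2 * (1 - b)) = u * (1 + b) / (2 * ((1 - b) * (1 + b)))" for u
    using pos by simp_all
  have ex: "z\<^sup>2 / 2 + ((x - a * z)\<^sup>2 / (2 * (1 - b)) + (y - a * z)\<^sup>2 / (2 * (1 - b))) =
    x\<^sup>2 / 2 + (y - b * x)\<^sup>2 / (2 * ((1 - b) * (1 + b))) + (z - a * (x + y) / (1 + b))\<^sup>2 / (2 * ((1 - b) / (1 + b)))"
    unfolding q cd(1)[of "z\<^sup>2"] cd(1)[of "x\<^sup>2"] cd(2)[of "(x - a * z)\<^sup>2"] cd(2)[of "(y - a * z)\<^sup>2"]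
    unfolding add_divide_distrib[symmetric] using alg by (simp only: add.assoc)
  have pf: "1 / sqrt (2 * pi * (1 - b)) * (1 / sqrt (2 * pi * (1 - b))) =
     1 / sqrt (2 * pi * ((1 - b) * (1 + b))) * (1 / sqrt (2 * pi * ((1 - b) / (1 + b))))"
  proof -
    have "2 * pi * (1 - b) * (2 * pi * (1 - b)) = (2 * pi * ((1 - b) * (1 + b))) * (2 * pi * ((1 - b) / (1 + b)))"
      using pos by simp
    then show ?thesis
      by (simp only: times_divide_times_eq real_sqrt_mult[symmetric])
  qed
  have m: "c1 * exp (- u1) * (c2 * exp (- u2) * (c3 * exp (- u3))) = c1 * (c2 * c3) * exp (- (u1 + (u2 + u3)))"
    "c1 * exp (- u1) * (c2 * exp (- u2)) * (c3 * exp (- u3)) = c1 * (c2 * c3) * exp (- (u1 + u2 + u3))" for c1 c2 c3 u1 u2 u3 :: real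
    by (simp_all add: exp_add[symmetric] ac_simps minus_add_distrib exp_diff)
      (simp_all add: exp_minus exp_add field_simps)
  have "0 < (1 - b) * (1 + b)" "0 < (1 - b) / (1 + b)" using pos by auto
  then have "std_normal_density z * (normal_density (a * z) (sqrt (1 - b)) x * normal_density (a * z) (sqrt (1 - b)) y) =
    (std_normal_density x * normal_density (b * x) (sqrt ((1 - b) * (1 + b))) y) *
      normal_density (a * (x + y) / (1 + b)) (sqrt ((1 - b) / (1 + b))) z"
    using pos by (simp only: n n1 m ex pf)
  then show ?thesis by (simp only: a4 b_def[symmetric])
qed

text \<open>Reversibility: going from one noisy copy back to the common source and on to the other
  copy takes time t twice. The proof compares densities and integrates out the source
  \<open>z\<close>.\<close>

lemma ou_pair_double:
  assumes t: "0 < t"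
  shows "ou_pair (2 * t) = distr (gauss \<Otimes>\<^sub>M (gauss \<Otimes>\<^sub>M gauss)) (borel \<Otimes>\<^sub>M borel)
    (\<lambda>p. (perturbed t (fst p) (fst (snd p)), perturbed t (fst p) (snd (snd p))))" (is "_ = ?D")
proof (rule measure_eqI)
  show "sets (ou_pair (2 * t)) = sets ?D" by (simp add: ou_pair_def)
next
  fix A assume "A \<in> sets (ou_pair (2 * t))"
  then have A[measurable]: "A \<in> sets (borel \<Otimes>\<^sub>M borel)" by (simp add: ou_pair_def)
  define G :: "real \<times> real \<Rightarrow> ennreal" where "G = indicator A"
  have G[measurable]: "G \<in> borel_measurable (borel \<Otimes>\<^sub>M borel)" unfolding G_def by measurable
  have [measurable]: "G \<in> borel_measurable (A \<Otimes>\<^sub>M B)" if "sets A = sets borel" "sets B = sets borel" for A B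
    using G measurable_cong_sets[OF sets_pair_measure_cong[OF that] refl] by blast
  define a s where "a = exp (- t)" and "s = sqrt (1 - a\<^sup>2)"
  have a: "0 < a" "a < 1" and a2: "a\<^sup>2 = exp (- 2 * t)" and a4: "a ^ 4 = exp (- 2 * (2 * t))"
    using t by (simp_all add: a_def exp_of_nat_mult[symmetric])
  have s: "0 < s" using a by (simp add: s_def power_less_one_iff)
  have p: "perturbed t x y = a * x + s * y" for x y
    by (simp add: perturbed_def a_def s_def exp_of_nat_mult[symmetric])
  let ?n = "\<lambda>z x. ennreal (normal_density (a * z) s x)"
  interpret g: prob_space gauss by (rule prob_space_gauss)
  interpret gg: pair_prob_space gauss gauss ..
  have "(\<integral>\<^sup>+p. G p \<partial>?D) = (\<integral>\<^sup>+p. G (perturbed t (fst p) (fst (snd p)), perturbed t (fst p) (snd (snd p))) \<partial>(gauss \<Otimes>\<^sub>M (gauss \<Otimes>\<^sub>M gauss)))"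
    by (rule nn_integral_distr) measurable
  also have "\<dots> = (\<integral>\<^sup>+z. \<integral>\<^sup>+x. \<integral>\<^sup>+y. G (a * z + s * x, a * z + s * y) \<partial>gauss \<partial>gauss \<partial>gauss)"
    by (subst gg.nn_integral_fst[symmetric], simp, intro nn_integral_cong)
      (subst g.nn_integral_fst[symmetric], simp_all add: p)
  also have "\<dots> = (\<integral>\<^sup>+z. \<integral>\<^sup>+x. \<integral>\<^sup>+y. ?n z y * G (a * z + s * x, y) \<partial>lborel \<partial>gauss \<partial>gauss)"
    by (intro nn_integral_cong nn_integral_gauss_affine[OF _ s]) measurable
  also have "\<dots> = (\<integral>\<^sup>+z. \<integral>\<^sup>+x. ?n z x * (\<integral>\<^sup>+y. ?n z y * G (x, y) \<partial>lborel) \<partial>lborel \<partial>gauss)"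
    by (intro nn_integral_cong nn_integral_gauss_affine[OF _ s]) measurable
  also have "\<dots> = (\<integral>\<^sup>+z. ennreal (std_normal_density z) * (\<integral>\<^sup>+x. ?n z x * (\<integral>\<^sup>+y. ?n z y * G (x, y) \<partial>lborel) \<partial>lborel) \<partial>lborel)"
    unfolding gauss_def by (rule nn_integral_density) measurable
  also have "\<dots> = (\<integral>\<^sup>+z. \<integral>\<^sup>+x. \<integral>\<^sup>+y. ennreal (std_normal_density z * (normal_density (a * z) s x * normal_density (a * z) s y)) * G (x, y) \<partial>lborel \<partial>lborel \<partial>lborel)"
    by (simp add: nn_integral_cmult[symmetric] ennreal_mult mult.assoc)
  also have "\<dots> = (\<integral>\<^sup>+x. \<integral>\<^sup>+z. \<integral>\<^sup>+y. ennreal (std_normal_density z * (normal_density (a * z) s x * normal_density (a * z) s y)) * G (x, y) \<partial>lborel \<partial>lborel \<partial>lborel)"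
    by (rule lborel_pair.Fubini') measurable
  also have "\<dots> = (\<integral>\<^sup>+x. \<integral>\<^sup>+y. \<integral>\<^sup>+z. ennreal (std_normal_density z * (normal_density (a * z) s x * normal_density (a * z) s y)) * G (x, y) \<partial>lborel \<partial>lborel \<partial>lborel)"
    by (intro nn_integral_cong lborel_pair.Fubini') measurable
  \<comment> \<open>The factor split off last is the conditional density of \<open>z\<close> given
    \<open>x\<close> and \<open>y\<close>, of total mass one.\<close>
  also have "\<dots> = (\<integral>\<^sup>+x. \<integral>\<^sup>+y. \<integral>\<^sup>+z. (ennreal (std_normal_density x * normal_density (a\<^sup>2 * x) (sqrt (1 - a ^ 4)) y) * G (x, y)) *
      ennreal (normal_density (a * (x + y) / (1 + a\<^sup>2)) (sqrt ((1 - a\<^sup>2) / (1 + a\<^sup>2))) z) \<partial>lborel \<partial>lborel \<partial>lborel)"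
    unfolding s_def ou_kernel_compose[OF a] by (simp add: ennreal_mult mult_ac)
  also have "\<dots> = (\<integral>\<^sup>+x. \<integral>\<^sup>+y. ennreal (std_normal_density x * normal_density (a\<^sup>2 * x) (sqrt (1 - a ^ 4)) y) * G (x, y) \<partial>lborel \<partial>lborel)"
  proof (intro nn_integral_cong)
    fix x y
    have "0 < 1 - a\<^sup>2" using a by (simp add: power_less_one_iff)
    then have "(\<integral>\<^sup>+z. ennreal (normal_density (a * (x + y) / (1 + a\<^sup>2)) (sqrt ((1 - a\<^sup>2) / (1 + a\<^sup>2))) z) \<partial>lborel) = 1"
      by (subst nn_integral_eq_integral) (auto simp: add_pos_nonneg)
    then show "(\<integral>\<^sup>+z. (ennreal (std_normal_density x * normal_density (a\<^sup>2 * x) (sqrt (1 - a ^ 4)) y) * G (x, y)) *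
      ennreal (normal_density (a * (x + y) / (1 + a\<^sup>2)) (sqrt ((1 - a\<^sup>2) / (1 + a\<^sup>2))) z) \<partial>lborel)
      = ennreal (std_normal_density x * normal_density (a\<^sup>2 * x) (sqrt (1 - a ^ 4)) y) * G (x, y)"
      by (subst nn_integral_cmult) simp_all
  qed
  also have "\<dots> = (\<integral>\<^sup>+p. G p \<partial>ou_pair (2 * t))"
    using nn_integral_ou_pair[OF G, of "2 * t"] t by (simp add: a2 a4)
  finally show "emeasure (ou_pair (2 * t)) A = emeasure ?D A"
    by (simp add: G_def ou_pair_def)
qed

section \<open>Correlations under noise\<close>

lemma PiM_distr_const:
  assumes "finite I" and "prob_space A" and [measurable]: "f \<in> A \<rightarrow>\<^sub>M B"
  shows "PiM I (\<lambda>_. distr A B f) = distr (PiM I (\<lambda>_. A)) (PiM I (\<lambda>_. B)) (compose I f)"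
proof -
  interpret prob_space A by fact
  have p: "prob_space (distr A B f)" by (rule prob_space_distr) simp
  have "distr (PiM I (\<lambda>_. A)) (PiM I (\<lambda>_. distr A B f)) (compose I f) = PiM I (\<lambda>_. distr A (distr A B f) f)"
    by (rule distr_PiM_finite_prob_space') (use assms p in auto)
  also have "distr A (distr A B f) f = distr A B f" by (rule distr_cong) auto
  also have "distr (PiM I (\<lambda>_. A)) (PiM I (\<lambda>_. distr A B f)) (compose I f) =
      distr (PiM I (\<lambda>_. A)) (PiM I (\<lambda>_. B)) (compose I f)"
    by (rule distr_cong[OF refl]) (intro sets_PiM_cong refl, simp_all)
  finally show ?thesis by simp
qed

lemma measurable_compose_PiM:
  assumes "f \<in> A \<rightarrow>\<^sub>M B"
  shows "compose I f \<in> PiM I (\<lambda>_. A) \<rightarrow>\<^sub>M PiM I (\<lambda>_. B)"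
  unfolding compose_def
proof (rule measurable_restrict)
  show "(\<lambda>x. f (x i)) \<in> PiM I (\<lambda>_. A) \<rightarrow>\<^sub>M B" if "i \<in> I" for i
    using measurable_compose[OF measurable_component_singleton[OF that, of "\<lambda>_. A"] assms] .
qed

lemma integral_PiM_distr_const:
  fixes G :: "_ \<Rightarrow> real"
  assumes "finite I" and "prob_space A" and f: "f \<in> A \<rightarrow>\<^sub>M B" and "G \<in> borel_measurable (PiM I (\<lambda>_. B))"
  shows "(\<integral>w. G w \<partial>PiM I (\<lambda>_. distr A B f)) = (\<integral>w. G (compose I f w) \<partial>PiM I (\<lambda>_. A))"
  unfolding PiM_distr_const[OF assms(1-3)]
  by (rule integral_distr[OF measurable_compose_PiM[OF f] assms(4)])

lemma (in prob_space) integrable_bounded: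
  fixes f :: "'a \<Rightarrow> real"
  assumes "f \<in> borel_measurable M" and "\<And>x. \<bar>f x\<bar> \<le> c"
  shows "integrable M f"
  by (rule integrable_const_bound[of _ c]) (use assms in auto)

text \<open>The bound \<open>c\<close> supplies the integrability that Fubini needs for signed
  functions.\<close>

lemma integral_PiM_pair:
  fixes G :: "_ \<Rightarrow> real"
  assumes "prob_space A" and "prob_space B" and "finite I"
    and G: "G \<in> borel_measurable (PiM I (\<lambda>_. A \<Otimes>\<^sub>M B))" and c: "\<And>x. \<bar>G x\<bar> \<le> c"
  shows "(\<integral>w. G w \<partial>PiM I (\<lambda>_. A \<Otimes>\<^sub>M B)) =
    (\<integral>u. \<integral>v. G (\<lambda>e\<in>I. (u e, v e)) \<partial>PiM I (\<lambda>_. B) \<partial>PiM I (\<lambda>_. A))"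
proof -
  interpret PA: prob_space "PiM I (\<lambda>_. A)" by (intro prob_space_PiM assms)
  interpret PB: prob_space "PiM I (\<lambda>_. B)" by (intro prob_space_PiM assms)
  interpret PAB: pair_prob_space "PiM I (\<lambda>_. A)" "PiM I (\<lambda>_. B)" ..
  have "integrable (PiM I (\<lambda>_. A) \<Otimes>\<^sub>M PiM I (\<lambda>_. B)) (\<lambda>p. G (\<lambda>e\<in>I. (fst p e, snd p e)))"
    by (rule PAB.integrable_bounded[OF measurable_compose[OF measurable_zip_PiM G] c])
  moreover have "(\<integral>w. G w \<partial>PiM I (\<lambda>_. A \<Otimes>\<^sub>M B)) =
      (\<integral>p. G (\<lambda>e\<in>I. (fst p e, snd p e)) \<partial>(PiM I (\<lambda>_. A) \<Otimes>\<^sub>M PiM I (\<lambda>_. B)))"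
    by (subst PiM_pair_eq_distr[OF assms(1-3)]) (rule integral_distr[OF measurable_zip_PiM G])
  ultimately show ?thesis using PAB.integral_fst' by fastforce
qed

text \<open>The function \<phi> of the overview, written over an array of pairs so that identities
  for a single \<open>ou_pair\<close> extend coordinatewise. The restrictions appear because points
  of \<open>PiM\<close> are extensional.\<close>

definition noise_corr :: "'e set \<Rightarrow> real \<Rightarrow> (('e \<Rightarrow> real) \<Rightarrow> real) \<Rightarrow> real" where
  "noise_corr I t F =
     (\<integral>w. F (\<lambda>e\<in>I. fst (w e)) * F (\<lambda>e\<in>I. snd (w e)) \<partial>PiM I (\<lambda>_. ou_pair t))"

lemma measurable_PiM_map:
  assumes "F \<in> borel_measurable (PiM I (\<lambda>_. N))" and "\<And>e. e \<in> I \<Longrightarrow> g e \<in> M \<rightarrow>\<^sub>M N"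
  shows "(\<lambda>w. F (\<lambda>e\<in>I. g e w)) \<in> borel_measurable M"
  by (rule measurable_compose[OF measurable_restrict assms(1)]) (use assms(2) in auto)

lemma measurable_PiM_map_coords:
  assumes "F \<in> borel_measurable (PiM I (\<lambda>_. K))" and "\<And>e. h e \<in> N \<rightarrow>\<^sub>M K"
  shows "(\<lambda>w. F (\<lambda>e\<in>I. h e (w e))) \<in> borel_measurable (PiM I (\<lambda>_. N))"
proof (rule measurable_PiM_map[OF assms(1)])
  show "(\<lambda>w. h e (w e)) \<in> PiM I (\<lambda>_. N) \<rightarrow>\<^sub>M K" if "e \<in> I" for e
    using measurable_compose[OF measurable_component_singleton[OF that, of "\<lambda>_. N"] assms(2)] .
qed

lemma integral_gaussian_disorder:
  assumes dis: "gaussian_disorder M N J J'" and N: "1 \<le> N" and I: "I = {1..N} \<times> {1..N}"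
    and F: "F \<in> borel_measurable (PiM I (\<lambda>_. borel))"
  shows "(\<integral>\<omega>. F (\<lambda>e\<in>I. J e \<omega>) * F (\<lambda>e\<in>I. perturbed t (J e \<omega>) (J' e \<omega>)) \<partial>M) = noise_corr I t F"
proof -
  interpret g: prob_space gauss by (rule prob_space_gauss)
  interpret gg: pair_prob_space gauss gauss ..
  have J: "J e \<in> borel_measurable M" "J' e \<in> borel_measurable M" if "e \<in> I" for e
    using dis that by (auto simp: gaussian_disorder_def I distributed_def)
  let ?h = "\<lambda>p. (fst p, perturbed t (fst p) (snd p))"
  let ?G = "\<lambda>w. F (\<lambda>e\<in>I. fst (w e)) * F (\<lambda>e\<in>I. perturbed t (fst (w e)) (snd (w e)))"
  have 1: "(\<lambda>w. F (\<lambda>e\<in>I. fst (w e)) * F (\<lambda>e\<in>I. snd (w e))) \<in> borel_measurable (PiM I (\<lambda>_. borel \<Otimes>\<^sub>M borel))"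
    by (intro borel_measurable_times measurable_PiM_map[OF F]) measurable
  have 2: "?G \<in> borel_measurable (PiM I (\<lambda>_. borel \<Otimes>\<^sub>M borel))"
    by (intro borel_measurable_times measurable_PiM_map[OF F]) measurable
  have "noise_corr I t F = (\<integral>w. ?G w \<partial>PiM I (\<lambda>_. gauss \<Otimes>\<^sub>M gauss))"
    unfolding noise_corr_def ou_pair_def
    by (subst integral_PiM_distr_const[OF _ _ _ 1]) (auto simp: I gg.prob_space_axioms compose_def cong: restrict_cong)
  also have "\<dots> = (\<integral>\<omega>. ?G (\<lambda>e\<in>I. (J e \<omega>, J' e \<omega>)) \<partial>M)"
    unfolding distr_gaussian_disorder[OF dis N I, symmetric]
    by (rule integral_distr[OF _ 2]) (intro measurable_restrict measurable_Pair J)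
  finally show ?thesis by (simp cong: restrict_cong)
qed

text \<open>Jensen's inequality for the mean of \<open>F\<close> times \<open>P\<close>, after which
  \<open>\<bar>F\<bar> \<le> 1\<close> discards the factor \<open>F\<close>.\<close>

lemma noise_corr_square_le:
  assumes t: "0 < t" and I: "finite I" and F: "F \<in> borel_measurable (PiM I (\<lambda>_. borel))"
    and F1: "\<And>g. \<bar>F g\<bar> \<le> 1"
  shows "(noise_corr I t F)\<^sup>2 \<le> noise_corr I (2 * t) F"
proof -
  interpret g: prob_space gauss by (rule prob_space_gauss)
  interpret gg: pair_prob_space gauss gauss ..
  interpret ggg: pair_prob_space gauss "gauss \<Otimes>\<^sub>M gauss" ..
  define \<Gamma> where "\<Gamma> = PiM I (\<lambda>_. gauss)"
  interpret \<Gamma>: prob_space \<Gamma> unfolding \<Gamma>_def by (intro prob_space_PiM prob_space_gauss)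
  interpret \<Gamma>2: pair_prob_space \<Gamma> \<Gamma> ..
  define p where "p x y = (\<lambda>e\<in>I. perturbed t (x e) (y e))" for x y :: "'a \<Rightarrow> real"
  \<comment> \<open>The Ornstein-Uhlenbeck semigroup at time t applied to \<open>F\<close>.\<close>
  define P where "P x = (\<integral>y. F (p x y) \<partial>\<Gamma>)" for x
  have mG: "(\<lambda>w. F (\<lambda>e\<in>I. fst (w e)) * F (\<lambda>e\<in>I. snd (w e))) \<in> borel_measurable (PiM I (\<lambda>_. borel \<Otimes>\<^sub>M borel))"
    by (intro borel_measurable_times measurable_PiM_map[OF F]) measurable
  have mp[measurable]: "(\<lambda>q. F (p (fst q) (snd q))) \<in> borel_measurable (\<Gamma> \<Otimes>\<^sub>M \<Gamma>)"
    unfolding p_def \<Gamma>_def by (intro measurable_PiM_map[OF F]) measurable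
  have m1: "(\<lambda>w. F (\<lambda>e\<in>I. fst (w e)) * F (\<lambda>e\<in>I. perturbed t (fst (w e)) (snd (w e)))) \<in> borel_measurable (PiM I (\<lambda>_. gauss \<Otimes>\<^sub>M gauss))"
    by (intro borel_measurable_times measurable_PiM_map[OF F]) measurable
  have m2: "(\<lambda>w. F (\<lambda>e\<in>I. perturbed t (fst (w e)) (fst (snd (w e)))) * F (\<lambda>e\<in>I. perturbed t (fst (w e)) (snd (snd (w e)))))
      \<in> borel_measurable (PiM I (\<lambda>_. gauss \<Otimes>\<^sub>M (gauss \<Otimes>\<^sub>M gauss)))"
    by (intro borel_measurable_times measurable_PiM_map_coords[OF F, where h="\<lambda>e q. perturbed t (fst q) (fst (snd q))"]
        measurable_PiM_map_coords[OF F, where h="\<lambda>e q. perturbed t (fst q) (snd (snd q))"]) measurable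
  have m3: "(\<lambda>w. F (\<lambda>e\<in>I. perturbed t (x e) (fst (w e))) * F (\<lambda>e\<in>I. perturbed t (x e) (snd (w e))))
      \<in> borel_measurable (PiM I (\<lambda>_. gauss \<Otimes>\<^sub>M gauss))" for x
    by (intro borel_measurable_times measurable_PiM_map_coords[OF F, where h="\<lambda>e q. perturbed t (x e) (fst q)"]
        measurable_PiM_map_coords[OF F, where h="\<lambda>e q. perturbed t (x e) (snd q)"]) measurable
  have FF: "\<bar>F u * F v\<bar> \<le> 1" for u v
    using mult_mono[OF F1[of u] F1[of v]] by (simp add: abs_mult)
  have mP[measurable]: "P \<in> borel_measurable \<Gamma>"
    unfolding P_def by measurable
  have P1: "\<bar>P x\<bar> \<le> 1" if x: "x \<in> space \<Gamma>" for x
  proof -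
    have i: "integrable \<Gamma> (\<lambda>y. F (p x y))"
    proof (rule \<Gamma>.integrable_bounded[where c=1])
      show "(\<lambda>y. F (p x y)) \<in> borel_measurable \<Gamma>" using measurable_Pair2[OF mp x] by simp
      show "\<bar>F (p x y)\<bar> \<le> 1" for y by (rule F1)
    qed
    have "\<bar>P x\<bar> \<le> (\<integral>y. \<bar>F (p x y)\<bar> \<partial>\<Gamma>)" unfolding P_def by (rule integral_abs_bound)
    also have "\<dots> \<le> (\<integral>y. 1 \<partial>\<Gamma>)"
      by (rule integral_mono[OF integrable_abs[OF i] \<Gamma>.integrable_const F1])
    finally show ?thesis by (simp add: \<Gamma>.prob_space)
  qed
  have mFr[measurable]: "(\<lambda>x. F (restrict x I)) \<in> borel_measurable \<Gamma>"
    unfolding \<Gamma>_def by (intro measurable_PiM_map[OF F]) measurable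
  have "noise_corr I t F = (\<integral>w. F (\<lambda>e\<in>I. fst (w e)) * F (\<lambda>e\<in>I. perturbed t (fst (w e)) (snd (w e))) \<partial>PiM I (\<lambda>_. gauss \<Otimes>\<^sub>M gauss))"
    unfolding noise_corr_def ou_pair_def
    by (subst integral_PiM_distr_const[OF _ _ _ mG]) (auto simp: I gg.prob_space_axioms compose_def cong: restrict_cong)
  also have "\<dots> = (\<integral>x. \<integral>y. F (restrict x I) * F (p x y) \<partial>\<Gamma> \<partial>\<Gamma>)"
    unfolding \<Gamma>_def p_def
    by (subst integral_PiM_pair[OF prob_space_gauss prob_space_gauss I m1 FF]) (simp cong: restrict_cong)
  also have "\<dots> = (\<integral>x. F (restrict x I) * P x \<partial>\<Gamma>)"
    by (simp add: P_def)
  finally have 1: "noise_corr I t F = (\<integral>x. F (restrict x I) * P x \<partial>\<Gamma>)" .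
  \<comment> \<open>By \<open>ou_pair_double\<close> both arguments are noisy copies of a common
    \<open>x\<close>. Given \<open>x\<close> they are independent with the same law, so the
    correlation becomes the mean of a square.\<close>
  have "noise_corr I (2 * t) F = (\<integral>w. F (\<lambda>e\<in>I. perturbed t (fst (w e)) (fst (snd (w e)))) *
      F (\<lambda>e\<in>I. perturbed t (fst (w e)) (snd (snd (w e)))) \<partial>PiM I (\<lambda>_. gauss \<Otimes>\<^sub>M (gauss \<Otimes>\<^sub>M gauss)))"
    unfolding noise_corr_def ou_pair_double[OF t]
    by (subst integral_PiM_distr_const[OF _ _ _ mG]) (auto simp: I ggg.prob_space_axioms compose_def cong: restrict_cong)
  also have "\<dots> = (\<integral>x. \<integral>w. F (\<lambda>e\<in>I. perturbed t (x e) (fst (w e))) * F (\<lambda>e\<in>I. perturbed t (x e) (snd (w e)))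
      \<partial>PiM I (\<lambda>_. gauss \<Otimes>\<^sub>M gauss) \<partial>\<Gamma>)"
    unfolding \<Gamma>_def p_def
    by (subst integral_PiM_pair[OF prob_space_gauss gg.prob_space_axioms I m2 FF]) (simp cong: restrict_cong)
  also have "\<dots> = (\<integral>x. \<integral>y. \<integral>y'. F (p x y) * F (p x y') \<partial>\<Gamma> \<partial>\<Gamma> \<partial>\<Gamma>)"
    unfolding \<Gamma>_def p_def
    by (intro Bochner_Integration.integral_cong refl, subst integral_PiM_pair[OF prob_space_gauss prob_space_gauss I m3 FF])
      (simp cong: restrict_cong)
  also have "\<dots> = (\<integral>x. (P x)\<^sup>2 \<partial>\<Gamma>)"
    by (simp add: P_def power2_eq_square)
  finally have 2: "noise_corr I (2 * t) F = (\<integral>x. (P x)\<^sup>2 \<partial>\<Gamma>)" .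
  have FP: "\<bar>F (restrict x I) * P x\<bar> \<le> 1" if "x \<in> space \<Gamma>" for x
    using mult_mono[OF F1[of "restrict x I"] P1[OF that]] by (simp add: abs_mult)
  have i1: "integrable \<Gamma> (\<lambda>x. F (restrict x I) * P x)"
    by (rule \<Gamma>.integrable_const_bound[of _ 1]) (auto intro!: AE_I2 simp: FP)
  have i2: "integrable \<Gamma> (\<lambda>x. (F (restrict x I) * P x)\<^sup>2)"
    by (rule \<Gamma>.integrable_const_bound[of _ 1]) (auto intro!: AE_I2 simp: FP abs_square_le_1)
  have i3: "integrable \<Gamma> (\<lambda>x. (P x)\<^sup>2)"
    by (rule \<Gamma>.integrable_const_bound[of _ 1]) (auto intro!: AE_I2 simp: P1 abs_square_le_1)
  \<comment> \<open>The variance is nonnegative.\<close>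
  have "(noise_corr I t F)\<^sup>2 \<le> (\<integral>x. (F (restrict x I) * P x)\<^sup>2 \<partial>\<Gamma>)"
    unfolding 1 using \<Gamma>.variance_positive[of "\<lambda>x. F (restrict x I) * P x"] \<Gamma>.variance_eq[OF i1 i2] by simp
  also have "\<dots> \<le> (\<integral>x. (P x)\<^sup>2 \<partial>\<Gamma>)"
    using i2 i3
  proof (rule integral_mono)
    fix x
    have "(F (restrict x I))\<^sup>2 \<le> 1" using F1 by (simp add: abs_square_le_1)
    then show "(F (restrict x I) * P x)\<^sup>2 \<le> (P x)\<^sup>2"
      by (simp add: power_mult_distrib mult_left_le_one_le)
  qed
  finally show ?thesis unfolding 2 .
qed

section \<open>Arrays invariant under sign changes\<close>

text \<open>The map may vary with the coordinate, so that one coordinate can be transformed and the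
  others left alone. Rectangles determine the measure.\<close>

lemma distr_PiM_invariant:
  assumes I: "finite I" and N: "prob_space N" and f[measurable]: "\<And>e. f e \<in> N \<rightarrow>\<^sub>M N" and inv: "\<And>e. distr N N (f e) = N"
  shows "distr (PiM I (\<lambda>_. N)) (PiM I (\<lambda>_. N)) (\<lambda>w. \<lambda>e\<in>I. f e (w e)) = PiM I (\<lambda>_. N)" (is "?D = _")
proof -
  interpret N: prob_space N by fact
  interpret product_sigma_finite "\<lambda>_. N" ..
  have c: "(\<lambda>w. f e (w e)) \<in> PiM I (\<lambda>_. N) \<rightarrow>\<^sub>M N" if "e \<in> I" for e
    using measurable_compose[OF measurable_component_singleton[OF that, of "\<lambda>_. N"] f] .
  have m: "(\<lambda>w. \<lambda>e\<in>I. f e (w e)) \<in> PiM I (\<lambda>_. N) \<rightarrow>\<^sub>M PiM I (\<lambda>_. N)"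
    by (rule measurable_restrict) (rule c)
  show ?thesis
  proof (rule PiM_eqI[OF I])
    fix A assume A: "\<And>i. i \<in> I \<Longrightarrow> A i \<in> sets N"
    have "(\<lambda>w. \<lambda>e\<in>I. f e (w e)) -` Pi\<^sub>E I A \<inter> space (PiM I (\<lambda>_. N)) = Pi\<^sub>E I (\<lambda>e. f e -` A e \<inter> space N)"
      by (auto simp: space_PiM PiE_iff)
    then have "emeasure ?D (Pi\<^sub>E I A) = emeasure (PiM I (\<lambda>_. N)) (Pi\<^sub>E I (\<lambda>e. f e -` A e \<inter> space N))"
      using A I by (subst emeasure_distr[OF m]) (auto intro!: sets_PiM_I_finite)
    also have "\<dots> = (\<Prod>e\<in>I. emeasure N (f e -` A e \<inter> space N))"
      using A I by (intro emeasure_PiM) auto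
    also have "\<dots> = (\<Prod>e\<in>I. emeasure (distr N N (f e)) (A e))"
      using A by (intro prod.cong refl) (simp add: emeasure_distr)
    finally show "emeasure ?D (Pi\<^sub>E I A) = (\<Prod>e\<in>I. emeasure N (A e))" by (simp add: inv)
  qed simp
qed

text \<open>With \<open>A T = E F(x) F(flip T y)\<close> one has \<open>A {} - A S = 2 A {}\<close>, and telescoping over \<open>S\<close> leaves
  differences \<open>A T - A (insert e T)\<close>; averaging each with its image under the simultaneous negation
  of \<open>x e\<close> and \<open>y e\<close> turns it into a product of two discrete derivatives.\<close>

lemma flip_correlation_bound:
  fixes F :: "('e \<Rightarrow> real) \<Rightarrow> real"
  defines "flip T b \<equiv> \<lambda>e. if e \<in> T then - b e else b e"
  assumes \<nu>: "prob_space \<nu>" and sets: "sets \<nu> = sets (borel \<Otimes>\<^sub>M borel)"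
    and inv: "distr \<nu> (borel \<Otimes>\<^sub>M borel) (\<lambda>p. (- fst p, - snd p)) = \<nu>"
    and int: "integrable \<nu> (\<lambda>p. \<bar>fst p\<bar> * \<bar>snd p\<bar>)"
    and I: "finite I" and S: "S \<subseteq> I"
    and F: "F \<in> borel_measurable (PiM I (\<lambda>_. borel))" and F1: "\<And>b. \<bar>F b\<bar> \<le> 1"
    and res: "\<And>b. F (restrict b I) = F b"
    and anti: "\<And>b. F (flip S b) = - F b"
    and lip: "\<And>e b. e \<in> S \<Longrightarrow> \<bar>F b - F (flip {e} b)\<bar> \<le> 2 * \<theta> * \<bar>b e\<bar>" and \<theta>: "0 \<le> \<theta>"
  shows "(\<integral>w. F (\<lambda>e\<in>I. fst (w e)) * F (\<lambda>e\<in>I. snd (w e)) \<partial>PiM I (\<lambda>_. \<nu>))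
    \<le> real (card S) * (\<theta>\<^sup>2 * (\<integral>p. \<bar>fst p\<bar> * \<bar>snd p\<bar> \<partial>\<nu>))"
proof -
  interpret \<nu>: prob_space \<nu> by fact
  define Q where "Q = PiM I (\<lambda>_. \<nu>)"
  interpret Q: prob_space Q unfolding Q_def by (intro prob_space_PiM \<nu>)
  define C where "C = (\<integral>p. \<bar>fst p\<bar> * \<bar>snd p\<bar> \<partial>\<nu>)"
  define A where "A T = (\<integral>w. F (\<lambda>e. fst (w e)) * F (flip T (\<lambda>e. snd (w e))) \<partial>Q)" for T
  have m\<nu>: "fst \<in> borel_measurable \<nu>" "snd \<in> borel_measurable \<nu>"
    by (simp_all add: measurable_cong_sets[OF sets refl])
  have mh: "(\<lambda>w. F (\<lambda>e. h e (w e))) \<in> borel_measurable Q" if "\<And>e. h e \<in> borel_measurable \<nu>" for h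
    using measurable_PiM_map_coords[OF F, of h \<nu>] that unfolding Q_def res by simp
  have mh1: "(\<lambda>w. F (flip T (\<lambda>e. fst (w e)))) \<in> borel_measurable Q"
    and mh2: "(\<lambda>w. F (flip T (\<lambda>e. snd (w e)))) \<in> borel_measurable Q"
    and mh3: "(\<lambda>w. F (\<lambda>e. fst (w e))) \<in> borel_measurable Q" for T
    using mh[of "\<lambda>e p. if e \<in> T then - fst p else fst p"] mh[of "\<lambda>e p. if e \<in> T then - snd p else snd p"]
      mh[of "\<lambda>e. fst"] m\<nu> by (simp_all add: flip_def)
  have FF: "\<bar>F u * F v\<bar> \<le> 1" for u v
    using mult_mono[OF F1[of u] F1[of v]] by (simp add: abs_mult)
  have iF: "integrable Q (\<lambda>w. F (f w) * F (g w))" if "(\<lambda>w. F (f w)) \<in> borel_measurable Q" "(\<lambda>w. F (g w)) \<in> borel_measurable Q" for f g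
    by (rule Q.integrable_bounded[OF borel_measurable_times[OF that] FF])
  have comp: "distr Q \<nu> (\<lambda>w. w e) = \<nu>" if "e \<in> I" for e
    unfolding Q_def using distr_PiM_component[of I "\<lambda>_. \<nu>" e] \<nu> that by simp
  have mcomp: "(\<lambda>w. w e) \<in> Q \<rightarrow>\<^sub>M \<nu>" if "e \<in> I" for e
    unfolding Q_def using that by (rule measurable_component_singleton)
  have mab: "(\<lambda>p. \<bar>fst p\<bar> * \<bar>snd p\<bar>) \<in> borel_measurable \<nu>" using int by (rule borel_measurable_integrable)
  have intC: "integrable Q (\<lambda>w. \<bar>fst (w e)\<bar> * \<bar>snd (w e)\<bar>)" "(\<integral>w. \<bar>fst (w e)\<bar> * \<bar>snd (w e)\<bar> \<partial>Q) = C" if "e \<in> I" for e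
    using integrable_distr_eq[OF mcomp[OF that] mab] integral_distr[OF mcomp[OF that] mab] comp[OF that] int
    by (simp_all add: C_def)
  have step: "A T - A (insert e T) \<le> 2 * \<theta>\<^sup>2 * C" if e: "e \<in> S" "e \<notin> T" for T e
  proof -
    have eI: "e \<in> I" using e S by auto
    \<comment> \<open>Negates both entries of the pair at \<open>e\<close>, whereas
      \<open>flip\<close> acts on one array only.\<close>
    define f where "f e' p = (if e' = e then (- fst p, - snd p) else p)" for e' and p :: "real \<times> real"
    define fw where "fw w = (\<lambda>e'\<in>I. f e' (w e'))" for w
    have fm: "f e' \<in> \<nu> \<rightarrow>\<^sub>M \<nu>" for e'
      unfolding f_def measurable_cong_sets[OF sets sets] by measurable
    have "distr \<nu> \<nu> (\<lambda>p. (- fst p, - snd p)) = distr \<nu> (borel \<Otimes>\<^sub>M borel) (\<lambda>p. (- fst p, - snd p))"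
      by (rule distr_cong) (simp_all add: sets)
    then have finv: "distr \<nu> \<nu> (f e') = \<nu>" for e'
    proof (cases "e' = e")
      case True
      then have "f e' = (\<lambda>p. (- fst p, - snd p))" by (auto simp: f_def)
      then show ?thesis using inv \<open>distr \<nu> \<nu> _ = _\<close> by simp
    next
      case False
      then have "f e' = (\<lambda>p. p)" by (auto simp: f_def)
      then show ?thesis by (simp add: distr_id2)
    qed
    have Qinv: "distr Q Q fw = Q"
      unfolding Q_def fw_def by (rule distr_PiM_invariant[OF I \<nu> fm finv])
    have fwm: "fw \<in> Q \<rightarrow>\<^sub>M Q"
      unfolding Q_def fw_def
      using measurable_compose[OF measurable_component_singleton[of _ I "\<lambda>_. \<nu>"] fm] by (intro measurable_restrict)
    have f1: "F (\<lambda>e'. fst (fw w e')) = F (flip {e} (\<lambda>e'. fst (w e')))" for w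
      by (subst (1 2) res[symmetric]) (auto simp: fw_def f_def flip_def cong: restrict_cong intro!: arg_cong[where f=F])
    have f2: "F (flip T' (\<lambda>e'. snd (fw w e'))) = F (flip T' (flip {e} (\<lambda>e'. snd (w e'))))" for w T'
      by (subst (1 2) res[symmetric]) (auto simp: fw_def f_def flip_def cong: restrict_cong intro!: arg_cong[where f=F])
    have ff1: "flip T (flip {e} b) = flip (insert e T) b" "flip (insert e T) (flip {e} b) = flip T b"
      "flip {e} (flip T b) = flip (insert e T) b" "flip T b e = b e" for b
      using e by (auto simp: flip_def fun_eq_iff)
    let ?x = "\<lambda>(w :: 'e \<Rightarrow> real \<times> real) e'. fst (w e')" and ?y = "\<lambda>(w :: 'e \<Rightarrow> real \<times> real) e'. snd (w e')"
    have tr: "(\<integral>w. F (?x w) * F (flip T' (?y w)) \<partial>Q) = (\<integral>w. F (flip {e} (?x w)) * F (flip T' (flip {e} (?y w))) \<partial>Q)" for T'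
    proof -
      have "(\<integral>w. F (?x w) * F (flip T' (?y w)) \<partial>Q) = (\<integral>w. F (?x w) * F (flip T' (?y w)) \<partial>distr Q Q fw)"
        by (simp add: Qinv)
      also have "\<dots> = (\<integral>w. F (?x (fw w)) * F (flip T' (?y (fw w))) \<partial>Q)"
        by (rule integral_distr[OF fwm]) (intro borel_measurable_times mh3 mh2)
      finally show ?thesis by (simp add: f1 f2)
    qed
    \<comment> \<open>The mean of two expressions for the left side. In the second, obtained from
      \<open>tr\<close>, \<open>flip T\<close> and \<open>flip (insert e T)\<close> have exchanged
      roles, so the difference in \<open>y\<close> changes sign and the terms factor.\<close>
    have d: "A T - A (insert e T) = (\<integral>w. (F (?x w) - F (flip {e} (?x w))) * (F (flip T (?y w)) - F (flip (insert e T) (?y w))) / 2 \<partial>Q)"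
      using tr[of T] tr[of "insert e T"]
        iF[OF mh3 mh2[of T]] iF[OF mh3 mh2[of "insert e T"]] iF[OF mh1[of "{e}"] mh2[of T]] iF[OF mh1[of "{e}"] mh2[of "insert e T"]]
      by (simp add: A_def ff1 algebra_simps)
    have "A T - A (insert e T) \<le> (\<integral>w. 2 * \<theta>\<^sup>2 * (\<bar>fst (w e)\<bar> * \<bar>snd (w e)\<bar>) \<partial>Q)"
      unfolding d
    proof (rule integral_mono)
      show "integrable Q (\<lambda>w. (F (?x w) - F (flip {e} (?x w))) * (F (flip T (?y w)) - F (flip (insert e T) (?y w))) / 2)"
        using iF[OF mh3 mh2[of T]] iF[OF mh3 mh2[of "insert e T"]] iF[OF mh1[of "{e}"] mh2[of T]] iF[OF mh1[of "{e}"] mh2[of "insert e T"]]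
        by (simp add: algebra_simps)
      show "integrable Q (\<lambda>w. 2 * \<theta>\<^sup>2 * (\<bar>fst (w e)\<bar> * \<bar>snd (w e)\<bar>))" using intC(1)[OF eI] by simp
      fix w
      have l1: "\<bar>F (?x w) - F (flip {e} (?x w))\<bar> \<le> 2 * \<theta> * \<bar>fst (w e)\<bar>" by (rule lip) fact
      have l2: "\<bar>F (flip T (?y w)) - F (flip (insert e T) (?y w))\<bar> \<le> 2 * \<theta> * \<bar>snd (w e)\<bar>"
        using lip[of e "flip T (?y w)"] e by (simp add: ff1)
      have "(F (?x w) - F (flip {e} (?x w))) * (F (flip T (?y w)) - F (flip (insert e T) (?y w)))
        \<le> \<bar>F (?x w) - F (flip {e} (?x w))\<bar> * \<bar>F (flip T (?y w)) - F (flip (insert e T) (?y w))\<bar>"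
        by (simp add: abs_mult[symmetric])
      also have "\<dots> \<le> (2 * \<theta> * \<bar>fst (w e)\<bar>) * (2 * \<theta> * \<bar>snd (w e)\<bar>)"
        using l1 l2 \<theta> by (intro mult_mono) auto
      finally show "(F (?x w) - F (flip {e} (?x w))) * (F (flip T (?y w)) - F (flip (insert e T) (?y w))) / 2
        \<le> 2 * \<theta>\<^sup>2 * (\<bar>fst (w e)\<bar> * \<bar>snd (w e)\<bar>)" by (simp add: power2_eq_square mult_ac)
    qed
    also have "\<dots> = 2 * \<theta>\<^sup>2 * C" using intC[OF eI] by simp
    finally show ?thesis .
  qed
  have fin: "finite S" using S I by (rule finite_subset)
  have "A {} - A T \<le> real (card T) * (2 * \<theta>\<^sup>2 * C)" if "T \<subseteq> S" for T
    using finite_subset[OF that fin] that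
  proof (induction T rule: finite_induct)
    case (insert e T)
    then show ?case using step[of e T] by (simp add: algebra_simps)
  qed simp
  from this[of S] have "A {} - A S \<le> real (card S) * (2 * \<theta>\<^sup>2 * C)" by simp
  moreover have "A S = - A {}" by (simp add: A_def anti) (simp add: flip_def)
  moreover have "(\<integral>w. F (\<lambda>e\<in>I. fst (w e)) * F (\<lambda>e\<in>I. snd (w e)) \<partial>PiM I (\<lambda>_. \<nu>)) = A {}"
    by (simp add: A_def Q_def res flip_def)
  ultimately show ?thesis by (simp add: C_def)
qed

section \<open>Gibbs averages of two spins\<close>

text \<open>Here \<theta> stands for \<beta> divided by the scale and \<open>b\<close> for the
  couplings \<open>\<rho> (g e)\<close>. Signs are changed on \<open>b\<close>, not on the
  Gaussians, because \<rho> need not be odd.\<close>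

definition boltzmann :: "nat \<Rightarrow> real \<Rightarrow> (nat \<times> nat \<Rightarrow> real) \<Rightarrow> (nat \<Rightarrow> real) \<Rightarrow> real" where
  "boltzmann N \<theta> b \<sigma> = exp (\<theta> * (\<Sum>e\<in>{1..N} \<times> {1..N}. b e * (\<sigma> (fst e) * \<sigma> (snd e))))"

definition spin_corr :: "nat \<Rightarrow> real \<Rightarrow> nat \<Rightarrow> nat \<Rightarrow> (nat \<times> nat \<Rightarrow> real) \<Rightarrow> real" where
  "spin_corr N \<theta> i j b =
     (\<Sum>\<sigma>\<in>spins N. \<sigma> i * \<sigma> j * boltzmann N \<theta> b \<sigma>) / (\<Sum>\<sigma>\<in>spins N. boltzmann N \<theta> b \<sigma>)"

lemma finite_spins [simp]: "finite (spins N)"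
  unfolding spins_def by (intro finite_PiE) auto

lemma spins_nonempty: "spins N \<noteq> {}"
  unfolding spins_def by (simp add: PiE_eq_empty_iff)

lemma spins_abs: "\<sigma> \<in> spins N \<Longrightarrow> k \<in> {1..N} \<Longrightarrow> \<bar>\<sigma> k\<bar> = 1"
  unfolding spins_def by (auto dest!: PiE_mem[of _ _ _ k])

lemma boltzmann_pos: "0 < boltzmann N \<theta> b \<sigma>"
  by (simp add: boltzmann_def)

lemma partition_function_pos: "0 < (\<Sum>\<sigma>\<in>spins N. boltzmann N \<theta> b \<sigma>)"
  by (intro sum_pos finite_spins spins_nonempty boltzmann_pos)

lemma gibbs_eq_boltzmann:
  "gibbs \<rho> a N \<beta> g \<sigma> = boltzmann N (\<beta> / a) (\<lambda>e. \<rho> (g e)) \<sigma> / (\<Sum>\<tau>\<in>spins N. boltzmann N (\<beta> / a) (\<lambda>e. \<rho> (g e)) \<tau>)"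
  by (simp add: gibbs_def boltzmann_def hamiltonian_def sum.cartesian_product' mult_ac)

text \<open>The squared overlap is a sum of products of a function of \<sigma> and the same function
  of \<tau>, and the product of the Gibbs measures factorises each term.\<close>

lemma gibbs_average2_overlap_sq:
  "gibbs_average2 \<rho> a N \<beta> g g' (\<lambda>\<sigma> \<tau>. (overlap N \<sigma> \<tau>)\<^sup>2) =
    (\<Sum>i=1..N. \<Sum>j=1..N. spin_corr N (\<beta> / a) i j (\<lambda>e. \<rho> (g e)) * spin_corr N (\<beta> / a) i j (\<lambda>e. \<rho> (g' e))) / (real N)\<^sup>2"
proof -
  define G where "G g \<sigma> = gibbs \<rho> a N \<beta> g \<sigma>" for g \<sigma>
  have c: "spin_corr N (\<beta> / a) i j (\<lambda>e. \<rho> (g e)) = (\<Sum>\<sigma>\<in>spins N. \<sigma> i * \<sigma> j * G g \<sigma>)" for i j g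
    by (simp add: spin_corr_def G_def gibbs_eq_boltzmann sum_divide_distrib)
  have o: "(overlap N \<sigma> \<tau>)\<^sup>2 = (\<Sum>i=1..N. \<Sum>j=1..N. \<sigma> i * \<sigma> j * (\<tau> i * \<tau> j)) / (real N)\<^sup>2" for \<sigma> \<tau>
    by (simp add: overlap_def power2_eq_square sum_product mult_ac)
  have "gibbs_average2 \<rho> a N \<beta> g g' (\<lambda>\<sigma> \<tau>. (overlap N \<sigma> \<tau>)\<^sup>2) =
    (\<Sum>\<sigma>\<in>spins N. \<Sum>\<tau>\<in>spins N. \<Sum>i=1..N. \<Sum>j=1..N. \<sigma> i * \<sigma> j * G g \<sigma> * (\<tau> i * \<tau> j * G g' \<tau>)) / (real N)\<^sup>2"
    unfolding gibbs_average2_def o G_def[symmetric] sum_divide_distrib[of _ "spins N"]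
  proof (intro sum.cong refl)
    fix \<sigma> \<tau> :: "nat \<Rightarrow> real"
    have "(\<Sum>i=1..N. \<Sum>j=1..N. \<sigma> i * \<sigma> j * (\<tau> i * \<tau> j)) * (G g \<sigma> * G g' \<tau>)
      = (\<Sum>i=1..N. \<Sum>j=1..N. \<sigma> i * \<sigma> j * G g \<sigma> * (\<tau> i * \<tau> j * G g' \<tau>))"
      unfolding sum_distrib_right by (simp add: mult_ac)
    then show "(\<Sum>i=1..N. \<Sum>j=1..N. \<sigma> i * \<sigma> j * (\<tau> i * \<tau> j)) / (real N)\<^sup>2 * G g \<sigma> * G g' \<tau>
      = (\<Sum>i=1..N. \<Sum>j=1..N. \<sigma> i * \<sigma> j * G g \<sigma> * (\<tau> i * \<tau> j * G g' \<tau>)) / (real N)\<^sup>2"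
      by (simp add: mult.assoc)
  qed
  also have "\<dots> = (\<Sum>\<sigma>\<in>spins N. \<Sum>i=1..N. \<Sum>j=1..N. \<Sum>\<tau>\<in>spins N. \<sigma> i * \<sigma> j * G g \<sigma> * (\<tau> i * \<tau> j * G g' \<tau>)) / (real N)\<^sup>2"
    by (subst sum.swap[of _ _ "spins N"], subst sum.swap[of _ _ "spins N"]) (rule refl)
  also have "\<dots> = (\<Sum>i=1..N. \<Sum>j=1..N. \<Sum>\<sigma>\<in>spins N. \<Sum>\<tau>\<in>spins N. \<sigma> i * \<sigma> j * G g \<sigma> * (\<tau> i * \<tau> j * G g' \<tau>)) / (real N)\<^sup>2"
    by (subst sum.swap, subst sum.swap[of _ _ "spins N"]) (rule refl)
  finally show ?thesis by (simp add: c sum_product)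
qed

lemma abs_spin_corr_le_1:
  assumes "i \<in> {1..N}" "j \<in> {1..N}"
  shows "\<bar>spin_corr N \<theta> i j b\<bar> \<le> 1"
proof -
  have "\<bar>\<Sum>\<sigma>\<in>spins N. \<sigma> i * \<sigma> j * boltzmann N \<theta> b \<sigma>\<bar> \<le> (\<Sum>\<sigma>\<in>spins N. \<bar>\<sigma> i * \<sigma> j * boltzmann N \<theta> b \<sigma>\<bar>)"
    by (rule sum_abs)
  also have "\<dots> = (\<Sum>\<sigma>\<in>spins N. boltzmann N \<theta> b \<sigma>)"
    using assms boltzmann_pos[of N \<theta> b] by (intro sum.cong refl) (simp add: abs_mult spins_abs less_imp_le)
  finally show ?thesis
    using partition_function_pos[of N \<theta> b] by (simp add: spin_corr_def)
qed

lemma spin_corr_restrict: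
  "spin_corr N \<theta> i j (restrict b ({1..N} \<times> {1..N})) = spin_corr N \<theta> i j b"
  by (simp add: spin_corr_def boltzmann_def cong: sum.cong)

lemma measurable_spin_corr:
  "spin_corr N \<theta> i j \<in> borel_measurable (PiM ({1..N} \<times> {1..N}) (\<lambda>_. borel))"
  unfolding spin_corr_def[abs_def] boltzmann_def
  by (intro borel_measurable_divide borel_measurable_sum borel_measurable_times borel_measurable_const
      borel_measurable_exp[THEN measurable_compose[rotated]] measurable_component_singleton)

text \<open>Gauge symmetry: negating the couplings at site \<open>i\<close> has the effect of negating the spin \<open>\<sigma> i\<close>.\<close>

lemma spin_corr_gauge:
  assumes "i \<in> {1..N}" "j \<in> {1..N}" "i \<noteq> j"
  shows "spin_corr N \<theta> i j (\<lambda>e. if e \<in> {e \<in> {1..N} \<times> {1..N}. (fst e = i) \<noteq> (snd e = i)} then - b e else b e)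
    = - spin_corr N \<theta> i j b"
    (is "spin_corr N \<theta> i j ?b = _")
proof -
  define \<phi> where "\<phi> \<sigma> = \<sigma>(i := - \<sigma> i)" for \<sigma> :: "nat \<Rightarrow> real"
  have \<phi>: "\<phi> (\<phi> \<sigma>) = \<sigma>" "\<sigma> \<in> spins N \<Longrightarrow> \<phi> \<sigma> \<in> spins N" for \<sigma>
    using assms by (auto simp: \<phi>_def spins_def PiE_iff extensional_def)
  have bij: "bij_betw \<phi> (spins N) (spins N)"
    by (rule bij_betw_byWitness[where f'=\<phi>]) (auto simp: \<phi>)
  have B: "boltzmann N \<theta> ?b \<sigma> = boltzmann N \<theta> b (\<phi> \<sigma>)" for \<sigma>
  proof -
    \<comment> \<open>The coupling at \<open>(i, i)\<close> multiplies the square of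
      \<open>\<sigma> i\<close> and must keep its sign; this explains the exclusive condition on the
      endpoints.\<close>
    have "(\<Sum>e\<in>{1..N} \<times> {1..N}. ?b e * (\<sigma> (fst e) * \<sigma> (snd e)))
      = (\<Sum>e\<in>{1..N} \<times> {1..N}. b e * (\<phi> \<sigma> (fst e) * \<phi> \<sigma> (snd e)))"
      by (intro sum.cong refl) (auto simp: \<phi>_def)
    then show ?thesis by (simp only: boltzmann_def)
  qed
  have "(\<Sum>\<sigma>\<in>spins N. \<sigma> i * \<sigma> j * boltzmann N \<theta> ?b \<sigma>) = (\<Sum>\<sigma>\<in>spins N. - (\<phi> \<sigma> i * \<phi> \<sigma> j * boltzmann N \<theta> b (\<phi> \<sigma>)))"
    unfolding B using assms by (simp add: \<phi>_def)
  also have "\<dots> = - (\<Sum>\<sigma>\<in>spins N. \<sigma> i * \<sigma> j * boltzmann N \<theta> b \<sigma>)"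
    unfolding sum_negf sum.reindex_bij_betw[OF bij, of "\<lambda>\<sigma>. \<sigma> i * \<sigma> j * boltzmann N \<theta> b \<sigma>"] ..
  finally have "(\<Sum>\<sigma>\<in>spins N. \<sigma> i * \<sigma> j * boltzmann N \<theta> ?b \<sigma>) = - (\<Sum>\<sigma>\<in>spins N. \<sigma> i * \<sigma> j * boltzmann N \<theta> b \<sigma>)" .
  moreover have "(\<Sum>\<sigma>\<in>spins N. boltzmann N \<theta> ?b \<sigma>) = (\<Sum>\<sigma>\<in>spins N. boltzmann N \<theta> b \<sigma>)"
    unfolding B by (rule sum.reindex_bij_betw[OF bij])
  ultimately show ?thesis by (simp only: spin_corr_def minus_divide_left)
qed

text \<open>The derivative of an exponentially tilted mean is the covariance of \<open>g\<close> and
  \<open>s\<close>, at most 2 when both are bounded by 1.\<close>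

lemma tilted_mean_lipschitz:
  fixes g r s :: "'i \<Rightarrow> real"
  assumes S: "finite S" "S \<noteq> {}" and r: "\<And>\<sigma>. \<sigma> \<in> S \<Longrightarrow> 0 < r \<sigma>"
    and g: "\<And>\<sigma>. \<sigma> \<in> S \<Longrightarrow> \<bar>g \<sigma>\<bar> \<le> 1" and s: "\<And>\<sigma>. \<sigma> \<in> S \<Longrightarrow> \<bar>s \<sigma>\<bar> \<le> 1"
  defines "h \<equiv> \<lambda>x. (\<Sum>\<sigma>\<in>S. g \<sigma> * (r \<sigma> * exp (x * s \<sigma>))) / (\<Sum>\<sigma>\<in>S. r \<sigma> * exp (x * s \<sigma>))"
  shows "\<bar>h x - h y\<bar> \<le> 2 * \<bar>x - y\<bar>"
proof -
  define Z where "Z u x = (\<Sum>\<sigma>\<in>S. u \<sigma> * (r \<sigma> * exp (x * s \<sigma>)))" for u x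
  have Z1: "0 < Z (\<lambda>_. 1) x" for x
    unfolding Z_def using S r by (intro sum_pos) auto
  have Zb: "\<bar>Z u x\<bar> \<le> Z (\<lambda>_. 1) x" if "\<And>\<sigma>. \<sigma> \<in> S \<Longrightarrow> \<bar>u \<sigma>\<bar> \<le> 1" for u x
    unfolding Z_def
    by (rule order_trans[OF sum_abs], rule sum_mono)
      (use that r in \<open>auto simp: abs_mult less_imp_le intro!: mult_right_mono\<close>)
  have dZ: "(Z u has_real_derivative Z (\<lambda>\<sigma>. u \<sigma> * s \<sigma>) x) (at x within A)" for u x A
    unfolding Z_def by (auto intro!: derivative_eq_intros simp: mult_ac)
  have h: "h = (\<lambda>x. Z g x / Z (\<lambda>_. 1) x)" by (simp add: h_def Z_def)
  have d: "(h has_real_derivative (Z (\<lambda>\<sigma>. g \<sigma> * s \<sigma>) x * Z (\<lambda>_. 1) x - Z g x * Z s x) / (Z (\<lambda>_. 1) x * Z (\<lambda>_. 1) x)) (at x within UNIV)" for x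
    unfolding h using DERIV_divide[OF dZ[of g x UNIV] dZ[of "\<lambda>_. 1" x UNIV]] Z1[of x] by simp
  have "\<bar>(Z (\<lambda>\<sigma>. g \<sigma> * s \<sigma>) x * Z (\<lambda>_. 1) x - Z g x * Z s x) / (Z (\<lambda>_. 1) x * Z (\<lambda>_. 1) x)\<bar> \<le> 2" for x
  proof -
    have "\<bar>Z (\<lambda>\<sigma>. g \<sigma> * s \<sigma>) x * Z (\<lambda>_. 1) x\<bar> \<le> Z (\<lambda>_. 1) x * Z (\<lambda>_. 1) x"
      unfolding abs_mult using Z1[of x] g s by (intro mult_mono Zb) (auto simp: abs_mult mult_le_one)
    moreover have "\<bar>Z g x * Z s x\<bar> \<le> Z (\<lambda>_. 1) x * Z (\<lambda>_. 1) x"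
      unfolding abs_mult using Z1[of x] g s by (intro mult_mono Zb) auto
    ultimately have "\<bar>Z (\<lambda>\<sigma>. g \<sigma> * s \<sigma>) x * Z (\<lambda>_. 1) x - Z g x * Z s x\<bar> \<le> 2 * (Z (\<lambda>_. 1) x * Z (\<lambda>_. 1) x)"
      by linarith
    then show ?thesis using Z1[of x] by (simp add: abs_divide divide_le_eq)
  qed
  from field_differentiable_bound[OF convex_UNIV d, unfolded real_norm_def, OF this UNIV_I UNIV_I]
  show ?thesis .
qed

text \<open>As a function of the single coupling \<open>b e\<close>, the Gibbs average is a mean
  tilted by \<open>\<theta> * b e\<close>, and the flip moves this parameter by
  \<open>2 * \<theta> * \<bar>b e\<bar>\<close>. The bound has the shape of \<open>lip\<close> in
  \<open>flip_correlation_bound\<close>, with \<open>2 * \<theta>\<close> for \<theta>.\<close>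

lemma spin_corr_flip_le:
  assumes "i \<in> {1..N}" "j \<in> {1..N}" "e \<in> {1..N} \<times> {1..N}" "0 \<le> \<theta>"
  shows "\<bar>spin_corr N \<theta> i j b - spin_corr N \<theta> i j (\<lambda>e'. if e' \<in> {e} then - b e' else b e')\<bar> \<le> 2 * (2 * \<theta>) * \<bar>b e\<bar>"
proof -
  define I where "I = {1..N} \<times> {1..N}"
  define r where "r \<sigma> = exp (\<theta> * (\<Sum>e\<in>I - {e}. b e * (\<sigma> (fst e) * \<sigma> (snd e))))" for \<sigma> :: "nat \<Rightarrow> real"
  define s where "s \<sigma> = \<sigma> (fst e) * \<sigma> (snd e)" for \<sigma> :: "nat \<Rightarrow> real"
  have B: "boltzmann N \<theta> b' \<sigma> = r \<sigma> * exp (\<theta> * b' e * s \<sigma>)" if "\<And>e'. e' \<noteq> e \<Longrightarrow> b' e' = b e'" for b' \<sigma>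
  proof -
    have "(\<Sum>e\<in>I. b' e * (\<sigma> (fst e) * \<sigma> (snd e))) = b' e * s \<sigma> + (\<Sum>e\<in>I - {e}. b e * (\<sigma> (fst e) * \<sigma> (snd e)))"
      using assms that by (subst sum.remove[of _ e]) (auto simp: I_def s_def)
    then show ?thesis
      unfolding boltzmann_def I_def[symmetric] r_def exp_add[symmetric] by (simp add: algebra_simps)
  qed
  have "\<bar>s \<sigma>\<bar> \<le> 1" "\<bar>\<sigma> i * \<sigma> j\<bar> \<le> 1" if "\<sigma> \<in> spins N" for \<sigma>
    using assms that by (auto simp: s_def abs_mult spins_abs)
  from tilted_mean_lipschitz[OF finite_spins spins_nonempty, where r=r and g="\<lambda>\<sigma>. \<sigma> i * \<sigma> j" and s=s
      and x="\<theta> * b e" and y="- (\<theta> * b e)", OF _ this(2) this(1)]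
  have "\<bar>spin_corr N \<theta> i j b - spin_corr N \<theta> i j (\<lambda>e'. if e' \<in> {e} then - b e' else b e')\<bar> \<le> 2 * \<bar>\<theta> * b e - - (\<theta> * b e)\<bar>"
    by (simp add: spin_corr_def B r_def)
  then show ?thesis using assms by (simp add: abs_mult)
qed

lemma card_star_le:
  "card {e \<in> {1..N} \<times> {1..N}. (fst e = i) \<noteq> (snd e = i)} \<le> 2 * N"
proof -
  have "card {e \<in> {1..N} \<times> {1..N}. (fst e = i) \<noteq> (snd e = i)} \<le> card ({i} \<times> {1..N} \<union> {1..N} \<times> {i})"
    by (rule card_mono) auto
  also have "\<dots> \<le> card ({i} \<times> {1..N}) + card ({1..N} \<times> {i})" by (rule card_Un_le)
  finally show ?thesis by simp
qed

section \<open>Monotone functions of Gaussian variables\<close>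

lemma gauss_pos_interval:
  assumes "x < y"
  shows "0 < measure gauss {x<..<y}"
proof -
  interpret prob_space gauss by (rule prob_space_gauss)
  have "{x<..<y} \<notin> null_sets gauss"
  proof
    assume "{x<..<y} \<in> null_sets gauss"
    then have "AE z in lborel. z \<in> {x<..<y} \<longrightarrow> ennreal (std_normal_density z) = 0"
      unfolding gauss_def by (subst (asm) null_sets_density_iff) auto
    then have "AE z in lborel. z \<notin> {x<..<y}"
      by eventually_elim (metis ennreal_eq_0_iff normal_density_pos not_le zero_less_one)
    then have "emeasure lborel {x<..<y} = 0"
      by (subst (asm) AE_iff_measurable[of "{x<..<y}"]) auto
    then show False using assms by simp
  qed
  then show ?thesis
    by (simp add: null_sets_def emeasure_eq_measure zero_less_measure_iff)
qed

text \<open>For each rational \<open>c\<close> at most one \<open>x\<close> satisfies \<open>f x \<le> c < g x\<close>, as two of them would give the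
  initial segments \<open>{f \<le> c}\<close> and \<open>{g \<le> c}\<close> different Gaussian measures.\<close>

lemma countable_mono_below:
  fixes f g :: "real \<Rightarrow> real"
  assumes f: "mono f" and g: "mono g" and d: "distr gauss borel f = distr gauss borel g"
  shows "countable {x. f x < g x}"
proof -
  interpret prob_space gauss by (rule prob_space_gauss)
  have m[measurable]: "f \<in> borel_measurable borel" "g \<in> borel_measurable borel"
    using f g by (auto intro: borel_measurable_mono)
  have eq: "measure gauss {x. f x \<le> c} = measure gauss {x. g x \<le> c}" for c
  proof -
    have "measure (distr gauss borel f) {..c} = measure (distr gauss borel g) {..c}" by (simp only: d)
    moreover have "f -` {..c} = {x. f x \<le> c}" "g -` {..c} = {x. g x \<le> c}" by auto
    ultimately show ?thesis by (simp add: measure_distr)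
  qed
  have one: "countable {x. f x \<le> c \<and> c < g x}" for c
  proof -
    have no: False if "f x \<le> c" "c < g x" "f y \<le> c" "c < g y" "x < y" for x y
    proof -
      \<comment> \<open>\<open>{g \<le> c}\<close> lies to the left of \<open>x\<close> while
        \<open>{f \<le> c}\<close> reaches \<open>y\<close>; the interval between them has positive
        Gaussian mass.\<close>
      have "{z. g z \<le> c} \<union> {x<..<y} \<subseteq> {z. f z \<le> c}"
      proof safe
        fix z assume "g z \<le> c"
        then have "z \<le> x" using that(2) monoD[OF g, of x z] by (meson le_cases not_le order_trans)
        then show "f z \<le> c" using that(1) monoD[OF f] order_trans by blast
      next
        fix z assume "z \<in> {x<..<y}"
        then show "f z \<le> c" using monoD[OF f, of z y] that(3) by auto
      qed
      then have "measure gauss ({z. g z \<le> c} \<union> {x<..<y}) \<le> measure gauss {z. f z \<le> c}"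
        by (intro finite_measure_mono) auto
      moreover have "{z. g z \<le> c} \<inter> {x<..<y} = {}"
      proof -
        have "\<not> g z \<le> c" if "x < z" for z
          using monoD[OF g, of x z] that \<open>c < g x\<close> by linarith
        then show ?thesis by auto
      qed
      ultimately show False
        using gauss_pos_interval[OF \<open>x < y\<close>] eq[of c] by (subst (asm) finite_measure_Union) auto
    qed
    have "\<exists>z. {x. f x \<le> c \<and> c < g x} \<subseteq> {z}"
      using no by (metis (mono_tags, lifting) linorder_neqE mem_Collect_eq singletonI subsetI)
    then show ?thesis by (meson countable_empty countable_insert countable_subset)
  qed
  have "{x. f x < g x} \<subseteq> (\<Union>c\<in>\<rat>. {x. f x \<le> c \<and> c < g x})"
  proof
    fix x assume "x \<in> {x. f x < g x}"
    then obtain c where "c \<in> \<rat>" "f x < c" "c < g x" using Rats_dense_in_real by auto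
    then show "x \<in> (\<Union>c\<in>\<rat>. {x. f x \<le> c \<and> c < g x})" by (auto intro!: bexI[of _ c])
  qed
  then show ?thesis
    by (rule countable_subset) (intro countable_UN countable_rat one)
qed

lemma distr_gauss_uminus: "distr gauss borel uminus = gauss"
proof -
  have "density lborel (\<lambda>x. ennreal (std_normal_density x)) = density (distr lborel borel uminus) (\<lambda>x. ennreal (std_normal_density x))"
    by (simp add: lborel_distr_uminus)
  also have "\<dots> = distr (density lborel (\<lambda>x. ennreal (std_normal_density (- x)))) borel uminus"
    by (rule density_distr) measurable
  also have "(\<lambda>x. ennreal (std_normal_density (- x))) = (\<lambda>x. ennreal (std_normal_density x))"
    by (simp add: std_normal_density_def)
  finally show ?thesis by (simp add: gauss_def)
qed

text \<open>The function \<open>- \<rho> (- x)\<close> is again nondecreasing with the same law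
  under \<open>gauss\<close>, so \<open>countable_mono_below\<close> applies in both directions. The
  law does not determine the values of \<rho> at its jumps, hence the exceptional set.\<close>

lemma odd_except_countable:
  fixes \<rho> :: "real \<Rightarrow> real"
  assumes "mono \<rho>" and "distr gauss borel (\<lambda>x. - \<rho> x) = distr gauss borel \<rho>"
  shows "countable {x. \<rho> (- x) \<noteq> - \<rho> x}"
proof -
  define g where "g x = - \<rho> (- x)" for x
  have g: "mono g" using assms(1) by (auto simp: g_def mono_def)
  have [measurable]: "\<rho> \<in> borel_measurable borel" using assms(1) by (rule borel_measurable_mono)
  have "distr gauss borel \<rho> = distr (distr gauss borel uminus) borel (\<lambda>x. - \<rho> x)"
    by (simp only: assms(2) distr_gauss_uminus)
  also have "\<dots> = distr gauss borel g"
    by (subst distr_distr) (auto simp: comp_def g_def[abs_def])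
  finally have d: "distr gauss borel \<rho> = distr gauss borel g" .
  have "{x. \<rho> (- x) \<noteq> - \<rho> x} \<subseteq> {x. \<rho> x < g x} \<union> {x. g x < \<rho> x}" by (auto simp: g_def)
  then show ?thesis
    by (rule countable_subset) (intro countable_Un countable_mono_below assms(1) g d d[symmetric])
qed

section \<open>Sign invariance of a pair of couplings\<close>

lemma sets_ou_pair [simp]: "sets (ou_pair t) = sets (borel \<Otimes>\<^sub>M borel)"
  and space_ou_pair [simp]: "space (ou_pair t) = UNIV"
  by (simp_all add: ou_pair_def space_pair_measure)

lemma prob_space_ou_pair: "prob_space (ou_pair t)"
proof -
  interpret g: prob_space gauss by (rule prob_space_gauss)
  interpret gg: pair_prob_space gauss gauss ..
  show ?thesis unfolding ou_pair_def by (rule gg.prob_space_distr) measurable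
qed

text \<open>For t > 0 the pair has a Lebesgue density. Used to discard the points where \<rho> fails
  to be odd.\<close>

lemma AE_ou_pair:
  assumes B: "countable B" and t: "0 < t"
  shows "AE p in ou_pair t. fst p \<notin> B \<and> snd p \<notin> B"
proof -
  have [measurable]: "B \<in> sets borel" using B by (rule sets.countable[rotated]) auto
  define A where "A = {p::real \<times> real. fst p \<in> B \<or> snd p \<in> B}"
  have A[measurable]: "A \<in> sets (borel \<Otimes>\<^sub>M borel)"
  proof -
    have "A = {p \<in> space (borel \<Otimes>\<^sub>M borel). fst p \<in> B \<or> snd p \<in> B}" by (simp add: A_def space_pair_measure)
    also have "\<dots> \<in> sets (borel \<Otimes>\<^sub>M borel)" by measurable
    finally show ?thesis .
  qed
  have nB: "AE x in lborel. x \<notin> B"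
    using countable_imp_null_set_lborel[OF B] by (rule AE_not_in)
  let ?k = "\<lambda>x y. ennreal (std_normal_density x * normal_density (exp (- t) * x) (sqrt (1 - exp (- 2 * t))) y)"
  have "emeasure (ou_pair t) A = (\<integral>\<^sup>+p. indicator A p \<partial>ou_pair t)" by simp
  also have "\<dots> = (\<integral>\<^sup>+x. \<integral>\<^sup>+y. ?k x y * indicator A (x, y) \<partial>lborel \<partial>lborel)"
    by (rule nn_integral_ou_pair[OF _ t]) measurable
  also have "\<dots> = (\<integral>\<^sup>+x. 0 \<partial>(lborel :: real measure))"
  proof (rule nn_integral_cong_AE)
    show "AE x in lborel. (\<integral>\<^sup>+y. ?k x y * indicator A (x, y) \<partial>lborel) = 0"
      using nB
    proof eventually_elim
      case (elim x)
      have "(\<integral>\<^sup>+y. ?k x y * indicator A (x, y) \<partial>lborel) = (\<integral>\<^sup>+y. 0 \<partial>(lborel :: real measure))"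
        using nB by (intro nn_integral_cong_AE, eventually_elim) (use elim in \<open>auto simp: A_def\<close>)
      then show ?case by simp
    qed
  qed
  finally have "A \<in> null_sets (ou_pair t)" by (simp add: null_sets_def)
  from AE_not_in[OF this] show ?thesis by (auto simp: A_def)
qed

text \<open>\<open>perturbed t\<close> is linear, hence commutes with negating both of its symmetric
  Gaussian inputs.\<close>

lemma ou_pair_uminus: "distr (ou_pair t) (borel \<Otimes>\<^sub>M borel) (\<lambda>p. (- fst p, - snd p)) = ou_pair t"
proof -
  interpret g: prob_space gauss by (rule prob_space_gauss)
  have "distr gauss borel uminus \<Otimes>\<^sub>M distr gauss borel uminus = distr (gauss \<Otimes>\<^sub>M gauss) (borel \<Otimes>\<^sub>M borel) (\<lambda>(x, y). (- x, - y))"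
    by (rule pair_measure_distr) (auto simp: distr_gauss_uminus g.sigma_finite_measure_axioms)
  then have gg: "gauss \<Otimes>\<^sub>M gauss = distr (gauss \<Otimes>\<^sub>M gauss) (borel \<Otimes>\<^sub>M borel) (\<lambda>p. (- fst p, - snd p))"
    by (simp add: distr_gauss_uminus split_beta')
  have "ou_pair t = distr (distr (gauss \<Otimes>\<^sub>M gauss) (borel \<Otimes>\<^sub>M borel) (\<lambda>p. (- fst p, - snd p))) (borel \<Otimes>\<^sub>M borel)
    (\<lambda>p. (fst p, perturbed t (fst p) (snd p)))"
    unfolding ou_pair_def by (subst gg) (rule refl)
  also have "\<dots> = distr (ou_pair t) (borel \<Otimes>\<^sub>M borel) (\<lambda>p. (- fst p, - snd p))"
    unfolding ou_pair_def by (subst (1 2) distr_distr) (auto simp: comp_def perturbed_def)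
  finally show ?thesis by simp
qed

text \<open>Supplies \<open>inv\<close> in \<open>flip_correlation_bound\<close>: almost surely,
  negating the couplings is the same as negating the Gaussians.\<close>

lemma distr_ou_pair_uminus:
  fixes \<rho> :: "real \<Rightarrow> real"
  assumes \<rho>: "mono \<rho>" and odd: "countable {x. \<rho> (- x) \<noteq> - \<rho> x}" and t: "0 < t"
  defines "\<nu> \<equiv> distr (ou_pair t) (borel \<Otimes>\<^sub>M borel) (\<lambda>p. (\<rho> (fst p), \<rho> (snd p)))"
  shows "distr \<nu> (borel \<Otimes>\<^sub>M borel) (\<lambda>p. (- fst p, - snd p)) = \<nu>"
proof -
  have [measurable]: "\<rho> \<in> borel_measurable borel" using \<rho> by (rule borel_measurable_mono)
  have [measurable]: "fst \<in> borel_measurable (ou_pair t)" "snd \<in> borel_measurable (ou_pair t)"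
    by (simp_all add: measurable_cong_sets[OF sets_ou_pair refl])
  have "distr \<nu> (borel \<Otimes>\<^sub>M borel) (\<lambda>p. (- fst p, - snd p)) = distr (ou_pair t) (borel \<Otimes>\<^sub>M borel) (\<lambda>p. (- \<rho> (fst p), - \<rho> (snd p)))"
    unfolding \<nu>_def by (subst distr_distr) (auto simp: comp_def)
  also have "\<dots> = distr (ou_pair t) (borel \<Otimes>\<^sub>M borel) (\<lambda>p. (\<rho> (- fst p), \<rho> (- snd p)))"
  proof (rule distr_cong_AE)
    show "AE p in ou_pair t. (- \<rho> (fst p), - \<rho> (snd p)) = (\<rho> (- fst p), \<rho> (- snd p))"
      using AE_ou_pair[OF odd t] by eventually_elim auto
  qed auto
  also have "\<dots> = distr (distr (ou_pair t) (borel \<Otimes>\<^sub>M borel) (\<lambda>p. (- fst p, - snd p))) (borel \<Otimes>\<^sub>M borel) (\<lambda>p. (\<rho> (fst p), \<rho> (snd p)))"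
    by (subst distr_distr) (auto simp: comp_def)
  also have "\<dots> = \<nu>" unfolding \<nu>_def ou_pair_uminus ..
  finally show ?thesis .
qed

section \<open>Crude hypercontractivity\<close>

text \<open>The exponent is the quadratic form \<open>(x^2 - 2 a x y + y^2) / (2 (1 - a^2))\<close>,
  whose smallest eigenvalue is \<open>1 / (2 (1 + a))\<close>. Bounding it below by this eigenvalue
  separates the variables.\<close>

lemma ou_kernel_le:
  fixes a a\<^sub>0 x y :: real
  assumes a: "0 \<le> a" "a \<le> a\<^sub>0" and a0: "a\<^sub>0 < 1"
  shows "std_normal_density x * normal_density (a * x) (sqrt (1 - a\<^sup>2)) y
    \<le> 1 / (2 * pi * sqrt (1 - a\<^sub>0\<^sup>2)) * (exp (- (x\<^sup>2 / (2 * (1 + a\<^sub>0)))) * exp (- (y\<^sup>2 / (2 * (1 + a\<^sub>0)))))"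
proof -
  have a1: "a < 1" "0 \<le> a\<^sub>0" using assms by auto
  have sq: "a\<^sup>2 \<le> a\<^sub>0\<^sup>2" using a by (rule power_mono[rotated])
  have v: "0 < 1 - a\<^sup>2" "0 < 1 - a\<^sub>0\<^sup>2" using a a1 a0 by (auto simp: power_less_one_iff abs_square_less_1)
  have n: "std_normal_density x * normal_density (a * x) (sqrt (1 - a\<^sup>2)) y
    = 1 / (2 * pi * sqrt (1 - a\<^sup>2)) * exp (- (x\<^sup>2 / 2 + (y - a * x)\<^sup>2 / (2 * (1 - a\<^sup>2))))"
  proof -
    have "1 / sqrt P * (1 / sqrt (P * w)) = 1 / (P * sqrt w)" if "0 < P" for P w :: real
      using that by (simp add: real_sqrt_mult)
    from this[of "2 * pi" "1 - a\<^sup>2"] have "1 / sqrt (2 * pi) * (1 / sqrt (2 * pi * (1 - a\<^sup>2))) = 1 / (2 * pi * sqrt (1 - a\<^sup>2))"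
      by simp
    then show ?thesis
      unfolding minus_add_distrib exp_add using v by (simp add: normal_density_def)
  qed
  have "(x\<^sup>2 + y\<^sup>2) / (2 * (1 + a\<^sub>0)) \<le> (x\<^sup>2 + y\<^sup>2) / (2 * (1 + a))"
    using a a1 by (intro divide_left_mono mult_pos_pos) auto
  also have "\<dots> = (1 - a) * (x\<^sup>2 + y\<^sup>2) / (2 * (1 - a\<^sup>2))"
  proof -
    have "1 - a\<^sup>2 = (1 - a) * (1 + a)" by (simp add: algebra_simps power2_eq_square)
    then show ?thesis using a1 by simp
  qed
  also have "\<dots> \<le> ((1 - a\<^sup>2) * x\<^sup>2 + (y - a * x)\<^sup>2) / (2 * (1 - a\<^sup>2))"
  proof (rule divide_right_mono)
    \<comment> \<open>Exactly the difference of the two sides of the goal.\<close>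
    have "0 \<le> a * (x - y)\<^sup>2" using a by simp
    then show "(1 - a) * (x\<^sup>2 + y\<^sup>2) \<le> (1 - a\<^sup>2) * x\<^sup>2 + (y - a * x)\<^sup>2"
      by (simp add: power2_eq_square algebra_simps)
  qed (use v in simp)
  also have "\<dots> = x\<^sup>2 / 2 + (y - a * x)\<^sup>2 / (2 * (1 - a\<^sup>2))"
  proof -
    have "1 - a\<^sup>2 \<noteq> 0" using v by simp
    from nonzero_mult_divide_mult_cancel_right2[OF this, of "x\<^sup>2" 2] show ?thesis
      unfolding add_divide_distrib by (simp only: mult.commute)
  qed
  finally have e: "exp (- (x\<^sup>2 / 2 + (y - a * x)\<^sup>2 / (2 * (1 - a\<^sup>2)))) \<le> exp (- ((x\<^sup>2 + y\<^sup>2) / (2 * (1 + a\<^sub>0))))"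
    by simp
  have "1 / (2 * pi * sqrt (1 - a\<^sup>2)) \<le> 1 / (2 * pi * sqrt (1 - a\<^sub>0\<^sup>2))"
    using v sq by (intro divide_left_mono mult_pos_pos mult_left_mono) auto
  then have "std_normal_density x * normal_density (a * x) (sqrt (1 - a\<^sup>2)) y
    \<le> 1 / (2 * pi * sqrt (1 - a\<^sub>0\<^sup>2)) * exp (- ((x\<^sup>2 + y\<^sup>2) / (2 * (1 + a\<^sub>0))))"
    unfolding n using e v by (intro mult_mono) auto
  then show ?thesis by (simp add: exp_add[symmetric] add_divide_distrib)
qed

text \<open>With \<open>y = x^2 / (2 (q + 1))\<close>, the first summand suffices if
  \<open>r \<le> exp y\<close>; otherwise \<open>r powr (q - 1)\<close> exceeds
  \<open>exp ((q - 1) * y)\<close> and the second one does. The second is a q-th power under the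
  Gaussian weight.\<close>

lemma mult_exp_le_powr:
  fixes r x q :: real
  assumes q: "1 < q" and r: "0 \<le> r"
  shows "r * exp (- (x\<^sup>2 / (q + 1))) \<le> exp (- (x\<^sup>2 / (2 * (q + 1)))) + r powr q * exp (- (x\<^sup>2 / 2))"
proof -
  define y where "y = x\<^sup>2 / (2 * (q + 1))"
  have y: "x\<^sup>2 / (q + 1) = 2 * y" "x\<^sup>2 / (2 * (q + 1)) = y" "x\<^sup>2 / 2 = (q + 1) * y"
    using q by (simp_all add: y_def divide_simps)
  have "r * exp (- (2 * y)) \<le> exp (- y) + r powr q * exp (- ((q + 1) * y))"
  proof (cases "r \<le> exp y")
    case True
    then have "r * exp (- (2 * y)) \<le> exp y * exp (- (2 * y))"
      by (rule mult_right_mono) simp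
    then show ?thesis by (simp add: exp_add[symmetric] add_increasing2)
  next
    case False
    then have rp: "exp y < r" "0 < r" using less_trans[OF exp_gt_zero, of y r] by auto
    have "exp ((q - 1) * y) = exp y powr (q - 1)"
      by (simp add: powr_def mult_ac)
    also have "\<dots> \<le> r powr (q - 1)" using rp q by (intro powr_mono2) auto
    finally have "r * exp (- ((q + 1) * y)) * exp ((q - 1) * y) \<le> r * exp (- ((q + 1) * y)) * r powr (q - 1)"
      using rp by (intro mult_left_mono) auto
    also have "r * exp (- ((q + 1) * y)) * exp ((q - 1) * y) = r * exp (- (2 * y))"
      by (simp add: mult.assoc exp_add[symmetric] algebra_simps)
    also have "r * exp (- ((q + 1) * y)) * r powr (q - 1) = r powr q * exp (- ((q + 1) * y))"
      using rp by (simp add: powr_mult_base mult_ac)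
    finally show ?thesis by (simp add: add_increasing)
  qed
  then show ?thesis by (simp only: y)
qed

text \<open>The separated kernel bound reduces the claim to the integrability of
  \<open>\<bar>\<rho>\<bar>\<close> against a weight that decays more slowly than the Gaussian
  density; the moment of order q > 1 pays for the difference.\<close>

lemma nn_integral_ou_pair_product_le:
  fixes \<rho> :: "real \<Rightarrow> real" and q :: real
  assumes [measurable]: "\<rho> \<in> borel_measurable borel" and q: "1 < q" "q < 3"
    and fin: "(\<integral>\<^sup>+x. ennreal (\<bar>\<rho> x\<bar> powr q) \<partial>gauss) < \<infinity>"
  shows "\<exists>C\<ge>0. \<forall>t>0. exp (- t) \<le> (q - 1) / 2 \<longrightarrow>
    (\<integral>\<^sup>+p. ennreal (\<bar>\<rho> (fst p)\<bar> * \<bar>\<rho> (snd p)\<bar>) \<partial>ou_pair t) \<le> ennreal C"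
proof -
  \<comment> \<open>Makes \<open>2 * (1 + a\<^sub>0)\<close> equal to \<open>q + 1\<close>, the
    exponent in \<open>mult_exp_le_powr\<close>; \<open>q < 3\<close> keeps it below 1.\<close>
  define a\<^sub>0 where "a\<^sub>0 = (q - 1) / 2"
  have a0: "0 < a\<^sub>0" "a\<^sub>0 < 1" "2 * (1 + a\<^sub>0) = q + 1"
    using q by (simp_all add: a\<^sub>0_def field_simps)
  define D where "D = 1 / (2 * pi * sqrt (1 - a\<^sub>0\<^sup>2))"
  define u where "u x = \<bar>\<rho> x\<bar> * exp (- (x\<^sup>2 / (q + 1)))" for x
  have [measurable]: "u \<in> borel_measurable borel" unfolding u_def by measurable
  have D0: "0 \<le> D" using a0 by (simp add: D_def abs_square_le_1)
  have u0: "0 \<le> u x" for x by (simp add: u_def)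
  define U where "U = (\<integral>\<^sup>+x. ennreal (u x) \<partial>lborel)"
  have "U \<le> (\<integral>\<^sup>+x. ennreal (exp (- (x\<^sup>2 / (2 * (q + 1))))) + ennreal (\<bar>\<rho> x\<bar> powr q * exp (- (x\<^sup>2 / 2))) \<partial>lborel)"
    unfolding U_def u_def using q
    by (intro nn_integral_mono) (use mult_exp_le_powr[OF q(1) abs_ge_zero] in \<open>simp add: ennreal_plus[symmetric] del: ennreal_plus\<close>)
  also have "\<dots> = (\<integral>\<^sup>+x. ennreal (exp (- (x\<^sup>2 / (2 * (q + 1))))) \<partial>lborel) + (\<integral>\<^sup>+x. ennreal (\<bar>\<rho> x\<bar> powr q * exp (- (x\<^sup>2 / 2))) \<partial>lborel)"
    by (rule nn_integral_add) measurable
  also have "\<dots> < \<infinity>"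
  proof -
    have 1: "ennreal (exp (- (x\<^sup>2 / (2 * (q + 1))))) = ennreal (sqrt (2 * pi * (q + 1))) * ennreal (normal_density 0 (sqrt (q + 1)) x)" for x
      using q by (simp add: normal_density_def ennreal_mult[symmetric])
    have "(\<integral>\<^sup>+x. ennreal (normal_density 0 (sqrt (q + 1)) x) \<partial>lborel) = 1"
      using q by (subst nn_integral_eq_integral) auto
    then have "(\<integral>\<^sup>+x. ennreal (exp (- (x\<^sup>2 / (2 * (q + 1))))) \<partial>lborel) < \<infinity>"
      unfolding 1 by (subst nn_integral_cmult) auto
    moreover have 2: "ennreal (\<bar>\<rho> x\<bar> powr q * exp (- (x\<^sup>2 / 2))) = ennreal (sqrt (2 * pi)) * (ennreal (std_normal_density x) * ennreal (\<bar>\<rho> x\<bar> powr q))" for x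
      by (simp add: std_normal_density_def ennreal_mult[symmetric] mult.assoc[symmetric])
    have "(\<integral>\<^sup>+x. ennreal (\<bar>\<rho> x\<bar> powr q * exp (- (x\<^sup>2 / 2))) \<partial>lborel) < \<infinity>"
      using fin unfolding 2 gauss_def
      by (subst nn_integral_cmult) (auto simp: nn_integral_density ennreal_mult_less_top)
    ultimately show ?thesis by simp
  qed
  finally have U: "U < \<infinity>" .
  then have Ut: "U * U < \<infinity>" by (simp add: ennreal_mult_less_top)
  have main: "(\<integral>\<^sup>+p. ennreal (\<bar>\<rho> (fst p)\<bar> * \<bar>\<rho> (snd p)\<bar>) \<partial>ou_pair t) \<le> ennreal D * (U * U)"
    if t: "0 < t" "exp (- t) \<le> a\<^sub>0" for t
  proof -
    have s: "exp (- 2 * t) = (exp (- t))\<^sup>2" by (simp add: exp_of_nat_mult[symmetric])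
    let ?k = "\<lambda>x y. std_normal_density x * normal_density (exp (- t) * x) (sqrt (1 - exp (- 2 * t))) y"
    have "(\<integral>\<^sup>+p. ennreal (\<bar>\<rho> (fst p)\<bar> * \<bar>\<rho> (snd p)\<bar>) \<partial>ou_pair t) = (\<integral>\<^sup>+x. \<integral>\<^sup>+y. ennreal (?k x y) * ennreal (\<bar>\<rho> x\<bar> * \<bar>\<rho> y\<bar>) \<partial>lborel \<partial>lborel)"
      by (subst nn_integral_ou_pair) (use t in auto)
    also have "\<dots> \<le> (\<integral>\<^sup>+x. \<integral>\<^sup>+y. ennreal (D * u x) * ennreal (u y) \<partial>lborel \<partial>lborel)"
    proof (intro nn_integral_mono)
      fix x y :: real
      have "?k x y * (\<bar>\<rho> x\<bar> * \<bar>\<rho> y\<bar>) \<le> D * (exp (- (x\<^sup>2 / (q + 1))) * exp (- (y\<^sup>2 / (q + 1)))) * (\<bar>\<rho> x\<bar> * \<bar>\<rho> y\<bar>)"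
        unfolding s D_def a0(3)[symmetric] using t a0 by (intro mult_right_mono ou_kernel_le) auto
      then have "?k x y * (\<bar>\<rho> x\<bar> * \<bar>\<rho> y\<bar>) \<le> D * u x * u y" by (simp add: u_def mult_ac)
      then show "ennreal (?k x y) * ennreal (\<bar>\<rho> x\<bar> * \<bar>\<rho> y\<bar>) \<le> ennreal (D * u x) * ennreal (u y)"
        using u0 D0 by (subst (1 2) ennreal_mult[symmetric]) (auto intro: ennreal_leI)
    qed
    also have "\<dots> = (\<integral>\<^sup>+x. ennreal (D * u x) * U \<partial>lborel)"
      unfolding U_def by (intro nn_integral_cong nn_integral_cmult) measurable
    also have "\<dots> = ennreal D * (U * U)"
      using D0 u0 by (simp add: ennreal_mult mult.assoc nn_integral_cmult nn_integral_multc U_def)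
    finally show ?thesis .
  qed
  obtain C where C: "0 \<le> C" "ennreal D * (U * U) = ennreal C"
    using Ut by (cases "ennreal D * (U * U)") (auto simp: ennreal_mult_eq_top_iff)
  show ?thesis
    using main C by (intro exI[of _ C]) (auto simp: a\<^sub>0_def)
qed

section \<open>Tails of the Levy variable\<close>

text \<open>Slow variation enters the proof only here, with factor 2 along powers of 2; monotonicity
  of the tail handles the points in between.\<close>

lemma levy_tail_ratio:
  assumes lv: "levy_variable \<alpha> L P X"
  defines "G \<equiv> \<lambda>x. measure P {\<omega> \<in> space P. x < \<bar>X \<omega>\<bar>}"
  shows "((\<lambda>k. G (2 ^ Suc k) / G (2 ^ k)) \<longlongrightarrow> 2 powr (- \<alpha>)) sequentially"
proof -
  have G: "G x = L x / x powr \<alpha>" if "0 < x" for x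
    using lv that by (simp add: levy_variable_def G_def)
  have "((\<lambda>x. L (2 * x) / L x) \<longlongrightarrow> 1) at_top"
    using lv by (simp add: levy_variable_def slowly_varying_def)
  moreover have "filterlim (\<lambda>k. 2 ^ k :: real) at_top sequentially"
    by (rule filterlim_at_top_mono[OF filterlim_real_sequentially])
      (auto intro!: always_eventually less_imp_le simp: of_nat_less_two_power)
  ultimately have "((\<lambda>k. L (2 * 2 ^ k) / L (2 ^ k)) \<longlongrightarrow> 1) sequentially"
    by (rule filterlim_compose)
  then have "((\<lambda>k. L (2 * 2 ^ k) / L (2 ^ k) * 2 powr (- \<alpha>)) \<longlongrightarrow> 1 * 2 powr (- \<alpha>)) sequentially"
    by (intro tendsto_mult tendsto_const)
  moreover have "L (2 * 2 ^ k) / L (2 ^ k) * 2 powr (- \<alpha>) = G (2 ^ Suc k) / G (2 ^ k)" for k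
    by (simp add: G powr_mult powr_minus field_simps)
  ultimately show ?thesis by simp
qed

lemma levy_tail_pos:
  assumes "levy_variable \<alpha> L P X" and "0 < x"
  shows "0 < measure P {\<omega> \<in> space P. x < \<bar>X \<omega>\<bar>}"
  using assms by (simp add: levy_variable_def)

lemma levy_tail_antimono:
  assumes lv: "levy_variable \<alpha> L P X" and "x \<le> y"
  shows "measure P {\<omega> \<in> space P. y < \<bar>X \<omega>\<bar>} \<le> measure P {\<omega> \<in> space P. x < \<bar>X \<omega>\<bar>}"
proof -
  interpret prob_space P using lv by (simp add: levy_variable_def)
  have [measurable]: "X \<in> borel_measurable P" using lv by (simp add: levy_variable_def)
  show ?thesis using assms(2) by (intro finite_measure_mono) auto
qed

text \<open>Ratio test: the limiting ratio is \<open>2 powr (q - \<alpha>)\<close>. The case q = 0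
  will show that the tail vanishes at infinity.\<close>

lemma levy_tail_summable:
  assumes lv: "levy_variable \<alpha> L P X" and q: "q < \<alpha>"
  shows "summable (\<lambda>k. 2 powr (q * real k) * measure P {\<omega> \<in> space P. 2 ^ k < \<bar>X \<omega>\<bar>})"
proof -
  define G where "G x = measure P {\<omega> \<in> space P. x < \<bar>X \<omega>\<bar>}" for x
  \<comment> \<open>The geometric mean of the limiting ratio and 1, hence strictly between
    them.\<close>
  define c where "c = 2 powr ((q - \<alpha>) / 2)"
  have c: "c < 1" using q powr_less_cancel_iff[of 2 "(q - \<alpha>) / 2" 0] by (simp add: c_def)
  have Gp: "0 < G (2 ^ k)" for k by (simp add: G_def levy_tail_pos[OF lv])
  have "- \<alpha> < (q - \<alpha>) / 2 + - q" using q by (simp add: field_simps)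
  then have "2 powr (- \<alpha>) < c * 2 powr (- q)"
    unfolding c_def powr_add[symmetric] by (subst powr_less_cancel_iff) auto
  then have "eventually (\<lambda>k. G (2 ^ Suc k) / G (2 ^ k) < c * 2 powr (- q)) sequentially"
    using levy_tail_ratio[OF lv] unfolding G_def by (rule order_tendstoD(2)[rotated])
  then obtain n where n: "\<And>k. n \<le> k \<Longrightarrow> G (2 ^ Suc k) / G (2 ^ k) < c * 2 powr (- q)"
    by (auto simp: eventually_sequentially)
  show ?thesis unfolding G_def[symmetric]
  proof (rule summable_ratio_test[OF c])
    fix k assume "n \<le> k"
    from n[OF this] have "G (2 ^ Suc k) \<le> c * 2 powr (- q) * G (2 ^ k)"
      using Gp[of k] by (simp add: field_simps)
    then have "2 powr (q * real (Suc k)) * G (2 ^ Suc k) \<le> 2 powr (q * real (Suc k)) * (c * 2 powr (- q) * G (2 ^ k))"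
      by (rule mult_left_mono) simp
    also have "\<dots> = c * (2 powr (q * real k) * G (2 ^ k))"
      by (simp add: algebra_simps powr_add powr_minus)
    finally show "norm (2 powr (q * real (Suc k)) * G (2 ^ Suc k)) \<le> c * norm (2 powr (q * real k) * G (2 ^ k))"
      using Gp[of k] Gp[of "Suc k"] by (simp add: abs_mult del: power_Suc)
  qed
qed

text \<open>Dyadic layers: on the layer where \<open>\<bar>X\<bar>\<close> lies between
  \<open>2 ^ k\<close> and \<open>2 ^ Suc k\<close>, its q-th power is at most
  \<open>2 powr (q * real (Suc k))\<close>.\<close>

lemma levy_moment_finite:
  assumes lv: "levy_variable \<alpha> L P X" and q: "0 < q" "q < \<alpha>"
  shows "(\<integral>\<^sup>+\<omega>. ennreal (\<bar>X \<omega>\<bar> powr q) \<partial>P) < \<infinity>"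
proof -
  interpret prob_space P using lv by (simp add: levy_variable_def)
  have [measurable]: "X \<in> borel_measurable P" using lv by (simp add: levy_variable_def)
  define G where "G x = measure P {\<omega> \<in> space P. x < \<bar>X \<omega>\<bar>}" for x
  define B where "B k = {\<omega> \<in> space P. 2 ^ k < \<bar>X \<omega>\<bar>}" for k :: nat
  have [measurable]: "B k \<in> sets P" for k unfolding B_def by measurable
  have pw: "ennreal (\<bar>X \<omega>\<bar> powr q) \<le> 1 + (\<Sum>k. ennreal (2 powr (q * real (Suc k))) * indicator (B k) \<omega>)" if \<omega>: "\<omega> \<in> space P" for \<omega>
  proof (cases "\<bar>X \<omega>\<bar> \<le> 1")
    case True
    then have "\<bar>X \<omega>\<bar> powr q \<le> 1" using q by (intro powr_le1) auto
    then have "ennreal (\<bar>X \<omega>\<bar> powr q) \<le> 1" by (simp add: ennreal_le_1)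
    then show ?thesis by (simp add: add_increasing2)
  next
    case False
    obtain m where "\<bar>X \<omega>\<bar> < 2 ^ m" using real_arch_pow[of 2 "\<bar>X \<omega>\<bar>"] by auto
    then have ex: "\<exists>m. \<bar>X \<omega>\<bar> \<le> 2 ^ m" by (auto intro: less_imp_le)
    \<comment> \<open>The least dyadic bound for \<open>\<bar>X \<omega>\<bar>\<close>; its
      predecessor is the index of the layer.\<close>
    define m' where "m' = (LEAST m. \<bar>X \<omega>\<bar> \<le> 2 ^ m)"
    have m': "\<bar>X \<omega>\<bar> \<le> 2 ^ m'" unfolding m'_def by (rule LeastI_ex[OF ex])
    then have "m' \<noteq> 0" using False by (intro notI) simp
    then obtain k where k: "m' = Suc k" by (cases m') auto
    have "\<not> \<bar>X \<omega>\<bar> \<le> 2 ^ k" using not_less_Least[of k "\<lambda>m. \<bar>X \<omega>\<bar> \<le> 2 ^ m"] k by (simp add: m'_def)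
    then have "\<omega> \<in> B k" using \<omega> by (simp add: B_def)
    have "\<bar>X \<omega>\<bar> powr q \<le> (2 ^ Suc k) powr q" using m' k q by (intro powr_mono2) auto
    also have "\<dots> = 2 powr (q * real (Suc k))" by (simp add: powr_realpow[symmetric] powr_powr mult.commute del: power_Suc of_nat_Suc)
    finally have "ennreal (\<bar>X \<omega>\<bar> powr q) \<le> ennreal (2 powr (q * real (Suc k))) * indicator (B k) \<omega>"
      using \<open>\<omega> \<in> B k\<close> by (simp add: ennreal_leI)
    also have "\<dots> \<le> (\<Sum>k. ennreal (2 powr (q * real (Suc k))) * indicator (B k) \<omega>)"
    proof -
      have "f k \<le> (\<Sum>k. f k)" for f :: "nat \<Rightarrow> ennreal"
        using sum_le_suminf[of f "{k}"] by simp
      then show ?thesis .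
    qed
    finally show ?thesis by (simp add: add_increasing)
  qed
  have "(\<integral>\<^sup>+\<omega>. ennreal (\<bar>X \<omega>\<bar> powr q) \<partial>P) \<le> (\<integral>\<^sup>+\<omega>. 1 + (\<Sum>k. ennreal (2 powr (q * real (Suc k))) * indicator (B k) \<omega>) \<partial>P)"
    by (intro nn_integral_mono pw)
  also have "\<dots> = 1 + (\<Sum>k. \<integral>\<^sup>+\<omega>. ennreal (2 powr (q * real (Suc k))) * indicator (B k) \<omega> \<partial>P)"
    by (simp add: nn_integral_add nn_integral_suminf emeasure_space_1)
  also have "\<dots> = 1 + (\<Sum>k. ennreal (2 powr q * (2 powr (q * real k) * G (2 ^ k))))"
    by (simp add: nn_integral_cmult_indicator emeasure_eq_measure G_def B_def ennreal_mult[symmetric] algebra_simps powr_add)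
  also have "\<dots> < \<infinity>"
  proof -
    have "summable (\<lambda>k. 2 powr q * (2 powr (q * real k) * G (2 ^ k)))"
      unfolding G_def by (rule summable_mult[OF levy_tail_summable[OF lv q(2)]])
    then have "(\<Sum>k. ennreal (2 powr q * (2 powr (q * real k) * G (2 ^ k)))) \<noteq> \<top>"
      by (rule ennreal_suminf_neq_top) (simp add: G_def)
    then show ?thesis by (simp add: less_top)
  qed
  finally show ?thesis .
qed

text \<open>A Potter-type bound. As p > \<alpha>, the sequence \<open>u\<close> is nondecreasing
  from some index \<open>n\<close> on, so the minimum of its values up to \<open>n\<close> bounds it
  from below.\<close>

lemma levy_tail_lower:
  assumes lv: "levy_variable \<alpha> L P X" and p: "\<alpha> < p" "0 < p"
  shows "\<exists>c>0. \<forall>x\<ge>1. c * x powr (- p) \<le> measure P {\<omega> \<in> space P. x < \<bar>X \<omega>\<bar>}"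
proof -
  define G where "G x = measure P {\<omega> \<in> space P. x < \<bar>X \<omega>\<bar>}" for x
  define u where "u k = 2 powr (p * real k) * G (2 ^ k)" for k :: nat
  have Gp: "0 < G (2 ^ k)" for k by (simp add: G_def levy_tail_pos[OF lv])
  have up: "0 < u k" for k using Gp by (simp add: u_def)
  have "2 powr (- p) < 2 powr (- \<alpha>)" using p by simp
  then have "eventually (\<lambda>k. 2 powr (- p) < G (2 ^ Suc k) / G (2 ^ k)) sequentially"
    using levy_tail_ratio[OF lv] unfolding G_def by (rule order_tendstoD(1)[rotated])
  then obtain n where n: "\<And>k. n \<le> k \<Longrightarrow> 2 powr (- p) < G (2 ^ Suc k) / G (2 ^ k)"
    by (auto simp: eventually_sequentially)
  have inc: "u k \<le> u (Suc k)" if "n \<le> k" for k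
  proof -
    have "2 powr (- p) * G (2 ^ k) \<le> G (2 ^ Suc k)" using n[OF that] Gp[of k] by (simp add: field_simps)
    then have "2 powr (p * real (Suc k)) * (2 powr (- p) * G (2 ^ k)) \<le> u (Suc k)"
      unfolding u_def by (rule mult_left_mono) simp
    moreover have "2 powr (p * real (Suc k)) * (2 powr (- p) * G (2 ^ k)) = u k"
      by (simp add: u_def algebra_simps powr_add powr_minus)
    ultimately show ?thesis by simp
  qed
  define c where "c = Min (u ` {..n})"
  have c0: "0 < c" unfolding c_def using up by (subst Min_gr_iff) auto
  have cu: "c \<le> u k" for k
  proof (cases "k \<le> n")
    case True
    then show ?thesis unfolding c_def by (intro Min_le) auto
  next
    case False
    then have "n \<le> k" by simp
    then have "u n \<le> u k" by (induction k rule: dec_induct) (use inc in \<open>auto intro: order_trans\<close>)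
    moreover have "c \<le> u n" unfolding c_def by (intro Min_le) auto
    ultimately show ?thesis by simp
  qed
  have "c * 2 powr (- p) * x powr (- p) \<le> G x" if x: "1 \<le> x" for x
  proof -
    obtain k where k: "2 ^ k \<le> x" "x < 2 ^ Suc k"
    proof -
      obtain m where m: "x < 2 ^ m" using real_arch_pow[of 2 x] by auto
      define m' where "m' = (LEAST m. x < 2 ^ m)"
      have m': "x < 2 ^ m'" unfolding m'_def by (rule LeastI[of _ m]) fact
      then have "m' \<noteq> 0" using x by (intro notI) simp
      then obtain k where k: "m' = Suc k" by (cases m') auto
      have "\<not> x < 2 ^ k" using not_less_Least[of k "\<lambda>m. x < 2 ^ m"] k by (simp add: m'_def)
      then show ?thesis using that[of k] m' k by (simp add: not_less)
    qed
    \<comment> \<open>The power of \<open>x\<close> is compared at \<open>2 ^ k\<close>, the tail at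
      \<open>2 ^ Suc k\<close>; the factor \<open>2 powr (- p)\<close> in the constant pays for this
      gap.\<close>
    have "x powr (- p) \<le> (2 ^ k) powr (- p)" using k p by (intro powr_mono2') auto
    also have "(2 ^ k :: real) powr (- p) = 2 powr (- (p * real k))" by (simp add: powr_realpow[symmetric] powr_powr mult.commute)
    finally have "c * 2 powr (- p) * x powr (- p) \<le> c * 2 powr (- p) * 2 powr (- (p * real k))"
      using c0 by (intro mult_left_mono) auto
    also have "\<dots> \<le> u (Suc k) * (2 powr (- p) * 2 powr (- (p * real k)))"
      unfolding mult.assoc using cu by (rule mult_right_mono) simp
    also have "\<dots> = G (2 ^ Suc k)" by (simp add: u_def algebra_simps powr_add powr_minus)
    also have "\<dots> \<le> G x" unfolding G_def using k by (intro levy_tail_antimono[OF lv]) auto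
    finally show ?thesis .
  qed
  then show ?thesis using c0 unfolding G_def by (intro exI[of _ "c * 2 powr (- p)"]) auto
qed

text \<open>Some admissible \<open>x\<close> lies below twice the infimum, and the tail is monotone.
  The factor 2 avoids the question whether the infimum is attained.\<close>

lemma levy_tail_scale:
  assumes lv: "levy_variable \<alpha> L P X" and \<alpha>: "0 < \<alpha>" and N: "1 \<le> N" and pos: "0 < levy_scale P X N"
  shows "measure P {\<omega> \<in> space P. 2 * levy_scale P X N < \<bar>X \<omega>\<bar>} \<le> 1 / real N"
proof -
  define G where "G x = measure P {\<omega> \<in> space P. x < \<bar>X \<omega>\<bar>}" for x
  \<comment> \<open>The tail tends to 0, so the set defining the infimum is nonempty.\<close>
  have "(\<lambda>k. 2 powr (0 * real k) * G (2 ^ k)) \<longlonglongrightarrow> 0"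
    unfolding G_def by (rule summable_LIMSEQ_zero[OF levy_tail_summable[OF lv \<alpha>]])
  then have "eventually (\<lambda>k. G (2 ^ k) < 1 / real N) sequentially"
    using N by (intro order_tendstoD(2)[where y=0]) auto
  then obtain k where "G (2 ^ k) < 1 / real N" by (auto simp: eventually_sequentially)
  then have ne: "2 ^ k \<in> {x. 0 < x \<and> G x \<le> 1 / real N}" by simp
  have "Inf {x. 0 < x \<and> G x \<le> 1 / real N} < 2 * levy_scale P X N"
    using pos by (simp add: levy_scale_def G_def)
  then obtain x where "x < 2 * levy_scale P X N" "G x \<le> 1 / real N"
    using cInf_lessD[of "{x. 0 < x \<and> G x \<le> 1 / real N}"] ne by blast
  moreover have "G (2 * levy_scale P X N) \<le> G x"
    unfolding G_def using calculation(1) by (intro levy_tail_antimono[OF lv]) simp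
  ultimately show ?thesis by (simp add: G_def)
qed

section \<open>Disorder chaos\<close>

lemma measurable_spin_corr_map:
  assumes "\<rho> \<in> borel_measurable borel"
  shows "(\<lambda>g. spin_corr N \<theta> i j (\<lambda>e. \<rho> (g e))) \<in> borel_measurable (PiM ({1..N} \<times> {1..N}) (\<lambda>_. borel))"
  using measurable_PiM_map_coords[OF measurable_spin_corr, of "\<lambda>_. \<rho>" borel] assms
  by (simp only: spin_corr_restrict)

lemma spin_corr_map_restrict:
  "spin_corr N \<theta> i j (\<lambda>e. \<rho> (restrict g ({1..N} \<times> {1..N}) e)) = spin_corr N \<theta> i j (\<lambda>e. \<rho> (g e))"
proof -
  have "restrict (\<lambda>e. \<rho> (restrict g ({1..N} \<times> {1..N}) e)) ({1..N} \<times> {1..N}) = restrict (\<lambda>e. \<rho> (g e)) ({1..N} \<times> {1..N})"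
    by auto
  then show ?thesis by (metis spin_corr_restrict)
qed

text \<open>\<open>flip_correlation_bound\<close> for the law \<nu> of a pair of couplings, with
  \<open>S\<close> the couplings joining \<open>i\<close> to another site. The factor 8 comes from
  at most \<open>2 * N\<close> such couplings times the square of
  \<open>2 * \<theta>\<close>.\<close>

lemma noise_corr_spin_corr_le:
  fixes \<rho> :: "real \<Rightarrow> real"
  assumes \<rho>: "mono \<rho>" and sym: "distr gauss borel (\<lambda>x. - \<rho> x) = distr gauss borel \<rho>" and t: "0 < t"
    and C: "0 \<le> C" "(\<integral>\<^sup>+p. ennreal (\<bar>\<rho> (fst p)\<bar> * \<bar>\<rho> (snd p)\<bar>) \<partial>ou_pair t) \<le> ennreal C"
    and ij: "i \<in> {1..N}" "j \<in> {1..N}" "i \<noteq> j" and \<theta>: "0 \<le> \<theta>"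
  shows "noise_corr ({1..N} \<times> {1..N}) t (\<lambda>g. spin_corr N \<theta> i j (\<lambda>e. \<rho> (g e))) \<le> 8 * real N * \<theta>\<^sup>2 * C"
proof -
  interpret ou: prob_space "ou_pair t" by (rule prob_space_ou_pair)
  have m\<rho>[measurable]: "\<rho> \<in> borel_measurable borel" using \<rho> by (rule borel_measurable_mono)
  have [measurable]: "fst \<in> borel_measurable (ou_pair t)" "snd \<in> borel_measurable (ou_pair t)"
    by (simp_all add: measurable_cong_sets[OF sets_ou_pair refl])
  have mr: "(\<lambda>p. (\<rho> (fst p), \<rho> (snd p))) \<in> ou_pair t \<rightarrow>\<^sub>M borel \<Otimes>\<^sub>M borel" by measurable
  define I where "I = {1..N} \<times> {1..N}"
  define S where "S = {e \<in> I. (fst e = i) \<noteq> (snd e = i)}"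
  define \<nu> where "\<nu> = distr (ou_pair t) (borel \<Otimes>\<^sub>M borel) (\<lambda>p. (\<rho> (fst p), \<rho> (snd p)))"
  let ?F = "spin_corr N \<theta> i j"
  have nn: "(\<integral>\<^sup>+p. ennreal (\<bar>fst p\<bar> * \<bar>snd p\<bar>) \<partial>\<nu>) \<le> ennreal C"
    unfolding \<nu>_def using C by (subst nn_integral_distr[OF mr]) auto
  have int: "integrable \<nu> (\<lambda>p. \<bar>fst p\<bar> * \<bar>snd p\<bar>)"
    by (rule integrableI_bounded) (use nn in \<open>auto simp: \<nu>_def less_top[symmetric] top_unique\<close>)
  have le: "(\<integral>p. \<bar>fst p\<bar> * \<bar>snd p\<bar> \<partial>\<nu>) \<le> C"
    using nn nn_integral_eq_integral[OF int] C by simp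
  have "noise_corr I t (\<lambda>g. ?F (\<lambda>e. \<rho> (g e))) =
      (\<integral>w. ?F (\<lambda>e. \<rho> (fst (w e))) * ?F (\<lambda>e. \<rho> (snd (w e))) \<partial>PiM I (\<lambda>_. ou_pair t))"
    unfolding noise_corr_def I_def by (simp only: spin_corr_map_restrict)
  also have "\<dots> = (\<integral>w. ?F (\<lambda>e\<in>I. fst (w e)) * ?F (\<lambda>e\<in>I. snd (w e)) \<partial>PiM I (\<lambda>_. \<nu>))"
  proof -
    have "(\<integral>w. ?F (\<lambda>e\<in>I. fst (w e)) * ?F (\<lambda>e\<in>I. snd (w e)) \<partial>PiM I (\<lambda>_. \<nu>))
      = (\<integral>w. ?F (\<lambda>e\<in>I. fst (compose I (\<lambda>p. (\<rho> (fst p), \<rho> (snd p))) w e)) *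
          ?F (\<lambda>e\<in>I. snd (compose I (\<lambda>p. (\<rho> (fst p), \<rho> (snd p))) w e)) \<partial>PiM I (\<lambda>_. ou_pair t))"
      unfolding \<nu>_def
    proof (rule integral_PiM_distr_const[OF _ ou.prob_space_axioms mr])
      show "finite I" by (simp add: I_def)
      show "(\<lambda>w. ?F (\<lambda>e\<in>I. fst (w e)) * ?F (\<lambda>e\<in>I. snd (w e))) \<in> borel_measurable (PiM I (\<lambda>_. borel \<Otimes>\<^sub>M borel))"
        unfolding I_def
        by (intro borel_measurable_times measurable_PiM_map_coords[OF measurable_spin_corr, where h="\<lambda>_. fst"]
            measurable_PiM_map_coords[OF measurable_spin_corr, where h="\<lambda>_. snd"]) auto
    qed
    also have "\<dots> = (\<integral>w. ?F (\<lambda>e\<in>I. \<rho> (fst (w e))) * ?F (\<lambda>e\<in>I. \<rho> (snd (w e))) \<partial>PiM I (\<lambda>_. ou_pair t))"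
      by (simp add: compose_def cong: restrict_cong)
    finally show ?thesis by (simp only: I_def spin_corr_restrict)
  qed
  also have "\<dots> \<le> real (card S) * ((2 * \<theta>)\<^sup>2 * (\<integral>p. \<bar>fst p\<bar> * \<bar>snd p\<bar> \<partial>\<nu>))"
  proof (rule flip_correlation_bound)
    show "prob_space \<nu>" unfolding \<nu>_def by (rule ou.prob_space_distr[OF mr])
    show "distr \<nu> (borel \<Otimes>\<^sub>M borel) (\<lambda>p. (- fst p, - snd p)) = \<nu>"
      unfolding \<nu>_def by (rule distr_ou_pair_uminus[OF \<rho> odd_except_countable[OF \<rho> sym] t])
    show "?F \<in> borel_measurable (PiM I (\<lambda>_. borel))" unfolding I_def by (rule measurable_spin_corr)
    show "\<bar>?F b\<bar> \<le> 1" for b using ij by (intro abs_spin_corr_le_1)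
    show "?F (restrict b I) = ?F b" for b unfolding I_def by (rule spin_corr_restrict)
    show "?F (\<lambda>e. if e \<in> S then - b e else b e) = - ?F b" for b
      unfolding S_def I_def by (rule spin_corr_gauge[OF ij])
    show "\<bar>?F b - ?F (\<lambda>e'. if e' \<in> {e} then - b e' else b e')\<bar> \<le> 2 * (2 * \<theta>) * \<bar>b e\<bar>" if "e \<in> S" for e b
      using that ij \<theta> by (intro spin_corr_flip_le) (auto simp: S_def I_def)
  qed (use int \<theta> in \<open>auto simp: \<nu>_def S_def I_def\<close>)
  also have "\<dots> \<le> real (2 * N) * ((2 * \<theta>)\<^sup>2 * C)"
    using card_star_le[of N i] le
    by (intro mult_mono mult_left_mono of_nat_mono mult_nonneg_nonneg integral_nonneg_AE)
      (auto simp: S_def I_def)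
  finally show ?thesis by (simp add: I_def power_mult_distrib mult_ac)
qed

lemma noise_corr_le_1:
  assumes "finite I" and "\<And>g. \<bar>F g\<bar> \<le> 1"
  shows "noise_corr I t F \<le> 1"
proof -
  interpret prob_space "PiM I (\<lambda>_. ou_pair t)" by (intro prob_space_PiM prob_space_ou_pair)
  have "F u * F v \<le> 1" for u v
    using mult_mono[OF assms(2)[of u] assms(2)[of v]] abs_ge_self[of "F u * F v"] by (simp add: abs_mult)
  then show ?thesis
    unfolding noise_corr_def
    \<comment> \<open>If the product is not integrable, its Bochner integral is 0 by convention and
      the bound still holds.\<close>
    by (cases "integrable (PiM I (\<lambda>_. ou_pair t)) (\<lambda>w. F (\<lambda>e\<in>I. fst (w e)) * F (\<lambda>e\<in>I. snd (w e)))")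
      (auto simp: not_integrable_integral_eq intro!: integral_le_const)
qed

lemma expected_overlap_sq_eq_noise_corr:
  assumes dis: "gaussian_disorder M N J J'" and N: "1 \<le> N" and \<rho>: "\<rho> \<in> borel_measurable borel"
  shows "expected_overlap_sq \<rho> a N \<beta> t M J J' =
    (\<Sum>i=1..N. \<Sum>j=1..N. noise_corr ({1..N} \<times> {1..N}) t (\<lambda>g. spin_corr N (\<beta> / a) i j (\<lambda>e. \<rho> (g e)))) / (real N)\<^sup>2"
proof -
  interpret prob_space M using dis by (simp add: gaussian_disorder_def)
  define I where "I = {1..N} \<times> {1..N}"
  define F where "F i j g = spin_corr N (\<beta> / a) i j (\<lambda>e. \<rho> (g e))" for i j and g :: "nat \<times> nat \<Rightarrow> real"
  have Fr: "F i j (restrict g I) = F i j g" for i j g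
    unfolding F_def I_def by (rule spin_corr_map_restrict)
  have Fm: "F i j \<in> borel_measurable (PiM I (\<lambda>_. borel))" for i j
    unfolding F_def I_def by (rule measurable_spin_corr_map[OF \<rho>])
  have J: "J e \<in> borel_measurable M" "J' e \<in> borel_measurable M" if "e \<in> I" for e
    using dis that by (auto simp: gaussian_disorder_def I_def distributed_def)
  have int: "integrable M (\<lambda>\<omega>. F i j (\<lambda>e. J e \<omega>) * F i j (\<lambda>e. perturbed t (J e \<omega>) (J' e \<omega>)))"
    if "i \<in> {1..N}" "j \<in> {1..N}" for i j
  proof (rule integrable_bounded[where c=1])
    have "(\<lambda>\<omega>. F i j (\<lambda>e\<in>I. J e \<omega>) * F i j (\<lambda>e\<in>I. perturbed t (J e \<omega>) (J' e \<omega>))) \<in> borel_measurable M"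
      by (intro borel_measurable_times measurable_PiM_map[OF Fm] measurable_perturbed J)
    then show "(\<lambda>\<omega>. F i j (\<lambda>e. J e \<omega>) * F i j (\<lambda>e. perturbed t (J e \<omega>) (J' e \<omega>))) \<in> borel_measurable M"
      by (simp only: Fr)
    have "\<bar>F i j g\<bar> \<le> 1" for g unfolding F_def by (rule abs_spin_corr_le_1[OF that])
    then show "\<bar>F i j (\<lambda>e. J e \<omega>) * F i j (\<lambda>e. perturbed t (J e \<omega>) (J' e \<omega>))\<bar> \<le> 1" for \<omega>
      by (simp add: abs_mult mult_le_one)
  qed
  have "expected_overlap_sq \<rho> a N \<beta> t M J J' =
    (\<integral>\<omega>. (\<Sum>i=1..N. \<Sum>j=1..N. F i j (\<lambda>e. J e \<omega>) * F i j (\<lambda>e. perturbed t (J e \<omega>) (J' e \<omega>))) / (real N)\<^sup>2 \<partial>M)"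
    by (simp add: expected_overlap_sq_def gibbs_average2_overlap_sq F_def)
  also have "\<dots> = (\<Sum>i=1..N. \<Sum>j=1..N. \<integral>\<omega>. F i j (\<lambda>e. J e \<omega>) * F i j (\<lambda>e. perturbed t (J e \<omega>) (J' e \<omega>)) \<partial>M) / (real N)\<^sup>2"
  proof -
    have "(\<integral>\<omega>. (\<Sum>i=1..N. \<Sum>j=1..N. F i j (\<lambda>e. J e \<omega>) * F i j (\<lambda>e. perturbed t (J e \<omega>) (J' e \<omega>))) \<partial>M)
      = (\<Sum>i=1..N. \<integral>\<omega>. (\<Sum>j=1..N. F i j (\<lambda>e. J e \<omega>) * F i j (\<lambda>e. perturbed t (J e \<omega>) (J' e \<omega>))) \<partial>M)"
      by (rule Bochner_Integration.integral_sum) (intro Bochner_Integration.integrable_sum int)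
    also have "\<dots> = (\<Sum>i=1..N. \<Sum>j=1..N. \<integral>\<omega>. F i j (\<lambda>e. J e \<omega>) * F i j (\<lambda>e. perturbed t (J e \<omega>) (J' e \<omega>)) \<partial>M)"
      by (intro sum.cong refl Bochner_Integration.integral_sum int)
    finally show ?thesis by simp
  qed
  also have "\<dots> = (\<Sum>i=1..N. \<Sum>j=1..N. noise_corr I t (F i j)) / (real N)\<^sup>2"
    using integral_gaussian_disorder[OF dis N I_def Fm] by (simp only: Fr)
  finally show ?thesis by (simp add: F_def[abs_def] I_def)
qed

section \<open>Interpolation in time, growth of the scale, and the conclusion\<close>

text \<open>Doubling the time k times carries \<open>t\<close> beyond \<open>T\<close> and turns
  \<open>M\<close> into \<open>M powr (1 / 2 ^ k)\<close>; since \<open>M \<le> 1\<close>, a lower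
  bound on the exponent for the least such k suffices.\<close>

lemma log_convex_interpolation:
  fixes \<phi> :: "real \<Rightarrow> real"
  assumes sq: "\<And>t. 0 < t \<Longrightarrow> (\<phi> t)\<^sup>2 \<le> \<phi> (2 * t)" and T: "0 < T" and t: "0 < t"
    and B: "\<And>t. T \<le> t \<Longrightarrow> \<phi> t \<le> K * M" and K: "1 \<le> K" and M: "0 < M" "M \<le> 1"
  shows "\<phi> t \<le> K * M powr min 1 (t / (2 * T))"
proof -
  have *: "\<phi> s \<le> K * M powr (1 / 2 ^ k)" if "0 < s" "T \<le> 2 ^ k * s" for k s
    using that
  proof (induction k arbitrary: s)
    case 0
    then show ?case using B M by simp
  next
    case (Suc k)
    have "(\<phi> s)\<^sup>2 \<le> \<phi> (2 * s)" by (rule sq) fact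
    also have "\<dots> \<le> K * M powr (1 / 2 ^ k)" using Suc by (intro Suc.IH) (auto simp: mult_ac)
    \<comment> \<open>Replacing K by its square keeps the constant the same at every root
      extraction.\<close>
    also have "\<dots> \<le> K * K * M powr (1 / 2 ^ k)" using K by (intro mult_right_mono) auto
    also have "\<dots> = (K * M powr (1 / 2 ^ Suc k))\<^sup>2"
      by (simp add: power2_eq_square powr_add[symmetric] mult_ac)
    finally show ?case by (rule power2_le_imp_le) (use K in simp)
  qed
  obtain m where "T / t < 2 ^ m" using real_arch_pow[of 2 "T / t"] by auto
  then have ex: "T \<le> 2 ^ m * t" using t by (simp add: field_simps)
  define k where "k = (LEAST m. T \<le> 2 ^ m * t)"
  have k: "T \<le> 2 ^ k * t" unfolding k_def by (rule LeastI) fact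
  \<comment> \<open>By minimality, for k > 0 one doubling fewer leaves the time below
    \<open>T\<close>.\<close>
  have "min 1 (t / (2 * T)) \<le> 1 / 2 ^ k"
  proof (cases k)
    case (Suc l)
    then have "\<not> T \<le> 2 ^ l * t" using not_less_Least[of l "\<lambda>m. T \<le> 2 ^ m * t"] by (simp add: k_def)
    then have "t / (2 * T) \<le> 1 / 2 ^ k" using T Suc by (simp add: field_simps)
    then show ?thesis by (rule min.coboundedI2)
  qed simp
  then have "M powr (1 / 2 ^ k) \<le> M powr min 1 (t / (2 * T))"
    using M by (intro powr_mono') auto
  then show ?thesis using *[OF t k] K by (meson mult_left_mono order_trans zero_le_one)
qed


text \<open>If \<open>2 a\<^sub>N < 1\<close>, then \<open>N \<le> 1 / P(|X| > 1)\<close>; the bound \<open>1\<close> in the minimum covers these finitely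
  many \<open>N\<close>.\<close>

lemma levy_scale_bound:
  assumes lv: "levy_variable \<alpha> L P X" and \<alpha>: "0 < \<alpha>"
    and \<gamma>: "0 < \<gamma>" "\<gamma> \<le> 1" "\<gamma> < 2 / \<alpha> - 1" and D: "0 \<le> D"
  shows "\<exists>K\<ge>1. \<forall>N\<ge>1. 0 < levy_scale P X N \<longrightarrow>
    min 1 (D * real N / (levy_scale P X N)\<^sup>2) \<le> K * real N powr (- \<gamma>)"
proof -
  define G where "G x = measure P {\<omega> \<in> space P. x < \<bar>X \<omega>\<bar>}" for x
  \<comment> \<open>Then 2 / p = \<gamma> + 1: a tail that is at least
    \<open>c * (2 * a) powr (- p)\<close> and at most 1/N forces the square of \<open>a\<close> to
    be at least of order \<open>real N powr (\<gamma> + 1)\<close>. The condition p > \<alpha> is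
    the upper bound on \<gamma>.\<close>
  define p where "p = 2 / (\<gamma> + 1)"
  have p: "0 < p" "\<alpha> < p" using \<alpha> \<gamma> by (auto simp: p_def field_simps)
  obtain c where c: "0 < c" "\<And>x. 1 \<le> x \<Longrightarrow> c * x powr (- p) \<le> G x"
    using levy_tail_lower[OF lv p(2,1)] unfolding G_def by auto
  have G1: "0 < G 1" unfolding G_def by (rule levy_tail_pos[OF lv]) simp
  \<comment> \<open>The three terms serve \<open>1 \<le> K\<close>, the case
    \<open>2 * a < 1\<close> and the case \<open>1 \<le> 2 * a\<close>.\<close>
  define K where "K = 1 + 1 / G 1 + 4 * D * c powr (- (\<gamma> + 1))"
  have K1: "1 \<le> K" "1 / G 1 \<le> K" "4 * D * c powr (- (\<gamma> + 1)) \<le> K"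
    using G1 D by (simp_all add: K_def)
  have "min 1 (D * real N / (levy_scale P X N)\<^sup>2) \<le> K * real N powr (- \<gamma>)"
    if N: "1 \<le> N" and a: "0 < levy_scale P X N" for N
  proof -
    define a where "a = levy_scale P X N"
    have a0: "0 < a" using that by (simp add: a_def)
    have GN: "G (2 * a) \<le> 1 / real N"
      unfolding G_def a_def by (rule levy_tail_scale[OF lv \<alpha> N that(2)])
    have NN: "0 < real N powr (- \<gamma>)" using N by simp
    show ?thesis
    proof (cases "1 \<le> 2 * a")
      case True
      have "c * (2 * a) powr (- p) \<le> 1 / real N" using c(2)[OF True] GN by simp
      then have "c * real N \<le> (2 * a) powr p"
        using N a0 by (simp add: powr_minus field_simps)
      then have "(c * real N) powr (2 / p) \<le> ((2 * a) powr p) powr (2 / p)"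
        using c p by (intro powr_mono2) auto
      also have "\<dots> = (2 * a) powr 2" using p by (simp add: powr_powr)
      also have "\<dots> = 4 * a\<^sup>2" using a0 by (simp add: powr_numeral power2_eq_square)
      also have "2 / p = \<gamma> + 1" using \<gamma> by (simp add: p_def)
      finally have "c powr (\<gamma> + 1) * real N powr (\<gamma> + 1) \<le> 4 * a\<^sup>2"
        using c by (simp add: powr_mult)
      then have "D * real N * (c powr (\<gamma> + 1) * real N powr (\<gamma> + 1)) \<le> D * real N * (4 * a\<^sup>2)"
        using D by (intro mult_left_mono) auto
      then have "D * real N / a\<^sup>2 \<le> 4 * D * real N / (c powr (\<gamma> + 1) * real N powr (\<gamma> + 1))"
        using a0 c N by (simp add: field_simps)
      also have "\<dots> = 4 * D * c powr (- (\<gamma> + 1)) * real N powr (- \<gamma>)"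
      proof -
        have "real N powr (- \<gamma>) = real N / real N powr (\<gamma> + 1)"
          using N by (simp add: powr_minus_divide powr_add)
        then show ?thesis unfolding powr_minus_divide[of c] by simp
      qed
      also have "\<dots> \<le> K * real N powr (- \<gamma>)" using K1(3) NN by (intro mult_right_mono) auto
      finally show ?thesis by (simp add: a_def)
    next
      case False
      then have "G 1 \<le> G (2 * a)" unfolding G_def by (intro levy_tail_antimono[OF lv]) simp
      then have "G 1 \<le> 1 / real N" using GN by simp
      then have "real N \<le> 1 / G 1" using G1 N by (simp add: field_simps)
      moreover have "real N powr \<gamma> \<le> real N powr 1" using N \<gamma> by (intro powr_mono) auto
      ultimately have "real N powr \<gamma> \<le> K" using K1(2) N by simp
      then have "1 \<le> K * real N powr (- \<gamma>)" using N by (simp add: powr_minus field_simps)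
      then show ?thesis by simp
    qed
  qed
  then show ?thesis using K1(1) by blast
qed

theorem theorem1p7:
  fixes \<alpha> \<beta> :: real and L \<rho> :: "real \<Rightarrow> real" and P :: "'b measure" and X :: "'b \<Rightarrow> real"
  assumes "1 < \<alpha>" and "\<alpha> < 2"
    and "levy_variable \<alpha> L P X"
    and "gaussian_representation \<rho> P X"
    and "0 \<le> \<beta>"
  shows "\<exists>c>0. \<forall>\<epsilon>. 0 < \<epsilon> \<and> \<epsilon> < 2 / \<alpha> - 1 \<longrightarrow>
    (\<exists>K>0. \<forall>t\<ge>0. \<forall>N\<ge>1. \<forall>(M :: 'a measure) J J'.
       levy_scale P X N > 0 \<and> gaussian_disorder M N J J' \<longrightarrow>
       expected_overlap_sq \<rho> (levy_scale P X N) N \<beta> t M J J'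
         \<le> K / real N powr ((2 / \<alpha> - 1 - \<epsilon>) * min 1 (c * t)))"
proof -
  note lv = assms(3)
  interpret P: prob_space P using lv by (simp add: levy_variable_def)
  have X[measurable]: "X \<in> borel_measurable P" using lv by (simp add: levy_variable_def)
  have \<rho>: "mono \<rho>" and d: "distr gauss borel \<rho> = distr P borel X"
    using assms(4) by (simp_all add: gaussian_representation_def gauss_def)
  have m\<rho>[measurable]: "\<rho> \<in> borel_measurable borel" using \<rho> by (rule borel_measurable_mono)
  have "distr gauss borel (\<lambda>x. - \<rho> x) = distr (distr gauss borel \<rho>) borel uminus"
    by (subst distr_distr) (auto simp: comp_def)
  also have "\<dots> = distr P borel (\<lambda>\<omega>. - X \<omega>)"
    unfolding d by (subst distr_distr) (auto simp: comp_def)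
  also have "\<dots> = distr gauss borel \<rho>" using lv d by (simp add: levy_variable_def)
  finally have sym: "distr gauss borel (\<lambda>x. - \<rho> x) = distr gauss borel \<rho>" .
  \<comment> \<open>Any exponent strictly between 1 and \<alpha> would do; the midpoint makes T
    explicit.\<close>
  define q where "q = (1 + \<alpha>) / 2"
  have q: "1 < q" "q < 3" "0 < q" "q < \<alpha>" using assms(1,2) by (auto simp: q_def)
  have "(\<integral>\<^sup>+x. ennreal (\<bar>\<rho> x\<bar> powr q) \<partial>gauss) = (\<integral>\<^sup>+x. ennreal (\<bar>x\<bar> powr q) \<partial>distr gauss borel \<rho>)"
    by (subst nn_integral_distr) auto
  also have "\<dots> = (\<integral>\<^sup>+\<omega>. ennreal (\<bar>X \<omega>\<bar> powr q) \<partial>P)"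
    unfolding d by (subst nn_integral_distr) auto
  also have "\<dots> < \<infinity>" by (rule levy_moment_finite[OF lv q(3,4)])
  finally obtain C where C: "0 \<le> C" "\<And>t. 0 < t \<Longrightarrow> exp (- t) \<le> (q - 1) / 2 \<Longrightarrow>
    (\<integral>\<^sup>+p. ennreal (\<bar>\<rho> (fst p)\<bar> * \<bar>\<rho> (snd p)\<bar>) \<partial>ou_pair t) \<le> ennreal C"
    using nn_integral_ou_pair_product_le[OF m\<rho> q(1,2)] by blast
  \<comment> \<open>The time at which \<open>exp (- T)\<close> equals the threshold
    \<open>(q - 1) / 2\<close>.\<close>
  define T where "T = - ln ((q - 1) / 2)"
  have T: "0 < T" using q(1,2) by (simp add: T_def ln_less_zero)
  have Tt: "exp (- t) \<le> (q - 1) / 2" if "T \<le> t" for t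
  proof -
    have "exp (- t) \<le> exp (- T)" using that by simp
    also have "\<dots> = (q - 1) / 2" using q(1) by (simp add: T_def)
    finally show ?thesis .
  qed
  show ?thesis
  proof (rule exI[of _ "1 / (2 * T)"], intro conjI allI impI)
    show "0 < 1 / (2 * T)" using T by simp
    fix \<epsilon> assume \<epsilon>: "0 < \<epsilon> \<and> \<epsilon> < 2 / \<alpha> - 1"
    define \<gamma> where "\<gamma> = 2 / \<alpha> - 1 - \<epsilon>"
    \<comment> \<open>This is where \<alpha> > 1 gives \<open>\<gamma> \<le> 1\<close>, needed for
      \<open>levy_scale_bound\<close> and for absorbing the diagonal.\<close>
    have "2 / \<alpha> < 2" using assms(1) by (simp add: divide_less_eq)
    then have \<gamma>: "0 < \<gamma>" "\<gamma> \<le> 1" "\<gamma> < 2 / \<alpha> - 1" using \<epsilon> by (auto simp: \<gamma>_def)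
    obtain K where K: "1 \<le> K" "\<And>N. 1 \<le> N \<Longrightarrow> 0 < levy_scale P X N \<Longrightarrow>
      min 1 ((8 * \<beta>\<^sup>2 * C) * real N / (levy_scale P X N)\<^sup>2) \<le> K * real N powr (- \<gamma>)"
      using levy_scale_bound[OF lv _ \<gamma>, of "8 * \<beta>\<^sup>2 * C"] assms(1) C(1) by auto
    show "\<exists>K>0. \<forall>t\<ge>0. \<forall>N\<ge>1. \<forall>(M :: 'a measure) J J'.
       levy_scale P X N > 0 \<and> gaussian_disorder M N J J' \<longrightarrow>
       expected_overlap_sq \<rho> (levy_scale P X N) N \<beta> t M J J'
         \<le> K / real N powr ((2 / \<alpha> - 1 - \<epsilon>) * min 1 (1 / (2 * T) * t))"
    \<comment> \<open>\<open>K\<close> comes from the pairs i \<noteq> j; the additional 1 pays for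
      i = j.\<close>
    proof (intro exI[of _ "K + 1"] conjI allI impI)
      show "0 < K + 1" using K by simp
      fix t :: real and N :: nat and M :: "'a measure" and J J'
      assume t: "0 \<le> t" and N: "1 \<le> N" and asm: "0 < levy_scale P X N \<and> gaussian_disorder M N J J'"
      define a where "a = levy_scale P X N"
      define \<theta> where "\<theta> = \<beta> / a"
      define I where "I = {1..N} \<times> {1..N}"
      define F where "F i j g = spin_corr N \<theta> i j (\<lambda>e. \<rho> (g e))" for i j and g :: "nat \<times> nat \<Rightarrow> real"
      have a: "0 < a" and dis: "gaussian_disorder M N J J'" using asm by (auto simp: a_def)
      have \<theta>: "0 \<le> \<theta>" using a assms(5) by (simp add: \<theta>_def)
      define m where "m = min 1 (t / (2 * T))"
      have m: "0 \<le> m" "m \<le> 1" using t T by (auto simp: m_def)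
      define Q where "Q = (real N powr (- \<gamma>)) powr m"
      have Nn: "real N powr (- \<gamma>) \<le> 1" using N \<gamma> powr_mono[of "- \<gamma>" 0 "real N"] by simp
      have F1: "\<bar>F i j g\<bar> \<le> 1" if "i \<in> {1..N}" "j \<in> {1..N}" for i j g
        unfolding F_def by (rule abs_spin_corr_le_1[OF that])
      have Fm: "F i j \<in> borel_measurable (PiM I (\<lambda>_. borel))" for i j
        unfolding F_def I_def by (rule measurable_spin_corr_map[OF m\<rho>])
      have finI: "finite I" by (simp add: I_def)
      have le1: "noise_corr I s (F i j) \<le> 1" if "i \<in> {1..N}" "j \<in> {1..N}" for i j s
        by (rule noise_corr_le_1[OF finI F1[OF that]])
      have off: "noise_corr I t (F i j) \<le> K * Q" if ij: "i \<in> {1..N}" "j \<in> {1..N}" "i \<noteq> j" for i j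
      \<comment> \<open>The interpolation needs t > 0; at t = 0 the target is \<open>K\<close>, and
        the trivial bound 1 suffices.\<close>
      proof (cases "t = 0")
        case True
        then have "Q = 1" using N by (simp add: Q_def m_def)
        then show ?thesis using le1[OF ij(1,2), of t] K(1) by simp
      next
        case False
        then have t0: "0 < t" using t by simp
        show ?thesis unfolding Q_def m_def
        proof (rule log_convex_interpolation[OF _ T t0 _ K(1) _ Nn])
          show "(noise_corr I s (F i j))\<^sup>2 \<le> noise_corr I (2 * s) (F i j)" if "0 < s" for s
            by (rule noise_corr_square_le[OF that finI Fm F1[OF ij(1,2)]])
          show "noise_corr I s (F i j) \<le> K * real N powr (- \<gamma>)" if s: "T \<le> s" for s
          proof -
            have s0: "0 < s" using s T by simp
            have "noise_corr I s (F i j) \<le> 8 * real N * \<theta>\<^sup>2 * C"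
              unfolding F_def I_def
              by (rule noise_corr_spin_corr_le[OF \<rho> sym s0 C(1) C(2)[OF s0 Tt[OF s]] ij \<theta>])
            also have "\<dots> = (8 * \<beta>\<^sup>2 * C) * real N / a\<^sup>2" by (simp add: \<theta>_def power_divide mult_ac)
            finally have "noise_corr I s (F i j) \<le> min 1 ((8 * \<beta>\<^sup>2 * C) * real N / a\<^sup>2)"
              using le1[OF ij(1,2), of s] by simp
            also have "\<dots> \<le> K * real N powr (- \<gamma>)" using K(2)[OF N] a by (simp add: a_def)
            finally show ?thesis .
          qed
        qed (use N in simp)
      qed
      have Q: "Q = 1 / real N powr (\<gamma> * m)"
        unfolding Q_def powr_powr mult_minus_left by (rule powr_minus_divide)
      have Q0: "0 < Q" using N by (simp add: Q_def)
      \<comment> \<open>The N diagonal terms, each at most 1, contribute 1/N to the average, which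
        is at most \<open>Q\<close> because this exponent does not exceed 1.\<close>
      have "\<gamma> * m \<le> 1" using \<gamma> m by (intro mult_le_one) auto
      then have "real N powr (\<gamma> * m) \<le> real N powr 1" using N by (intro powr_mono) auto
      then have NQ: "1 \<le> real N * Q" using N by (simp add: Q field_simps)
      have "expected_overlap_sq \<rho> a N \<beta> t M J J' = (\<Sum>i=1..N. \<Sum>j=1..N. noise_corr I t (F i j)) / (real N)\<^sup>2"
        unfolding expected_overlap_sq_eq_noise_corr[OF dis N m\<rho>] F_def[abs_def] I_def \<theta>_def ..
      also have "\<dots> \<le> (\<Sum>i=1..N. \<Sum>j=1..N. K * Q + (if i = j then 1 else 0)) / (real N)\<^sup>2"
      proof (intro divide_right_mono sum_mono)
        fix i j assume ij: "i \<in> {1..N}" "j \<in> {1..N}"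
        show "noise_corr I t (F i j) \<le> K * Q + (if i = j then 1 else 0)"
          using le1[OF ij, of t] off[OF ij] K(1) Q0 by (cases "i = j") (auto intro: add_increasing)
      qed simp
      also have "\<dots> = (real N * (real N * (K * Q)) + real N) / (real N)\<^sup>2"
        by (simp add: sum.distrib distrib_left)
      also have "\<dots> = K * Q + 1 / real N" using N by (simp add: field_simps power2_eq_square)
      also have "\<dots> \<le> K * Q + Q" using NQ N by (simp add: field_simps)
      also have "\<dots> = (K + 1) / real N powr (\<gamma> * m)" by (simp add: Q add_divide_distrib)
      finally show "expected_overlap_sq \<rho> (levy_scale P X N) N \<beta> t M J J'
         \<le> (K + 1) / real N powr ((2 / \<alpha> - 1 - \<epsilon>) * min 1 (1 / (2 * T) * t))"
        unfolding a_def \<gamma>_def m_def by simp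
    qed
  qed
qed

end
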